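(* For every $\varepsilon'>0$ there exist $\delta=\delta(\varepsilon')>0$ and $n_0$ such that the following holds for every odd integer $n=2\ell+1\ge n_0$. If $\mathcal{G}\subseteq 2^{[n]}$ is a $(1-\delta)$-$2$-generator for $[n]$ with $|\mathcal{G}|\le 2^{\lfloor n/2\rfloor}+2^{\lceil n/2\rceil}=3\cdot 2^{\ell}$, then there exists $S\subseteq[n]$ with $|S|=\lfloor n/2\rfloor=\ell$ such that, with $\mathcal{F}_0=\{A: A\subseteq S\}\cup\{B: B\subseteq S^c\}$, we have $|\mathcal{G}\,\Delta\,\mathcal{F}_0|\le\varepsilon' 2^{\ell}$.
   Context: $[n]=\{1,\ldots,n\}$, $S^c=[n]\setminus S$, $\Delta$ is symmetric difference. A family $\mathcal{H}\subseteq 2^{[n]}$ is a $(1-\varepsilon)$-$k$-generator for $[n]$ if all but at most $\varepsilon 2^n$ subsets of $[n]$ can be expressed as a union of at most $k$ pairwise disjoint sets of $\mathcal{H}$. *)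

theory Defs
  imports Complex_Main "HOL-Library.Disjoint_Sets"
begin

definition k_union :: "nat set set \<Rightarrow> nat \<Rightarrow> nat set \<Rightarrow> bool" where
  "k_union H k X \<longleftrightarrow> (\<exists>C. C \<subseteq> H \<and> finite C \<and> card C \<le> k \<and> disjoint C \<and> \<Union>C = X)"

definition approx_generator :: "nat \<Rightarrow> real \<Rightarrow> nat \<Rightarrow> nat set set \<Rightarrow> bool" where
  "approx_generator n eps k H \<longleftrightarrow>
     H \<subseteq> Pow {1..n} \<and>
     real (card {X \<in> Pow {1..n}. \<not> k_union H k X}) \<le> eps * 2 ^ n"

end

theory Submission
  imports Defs
begin

text \<open>
  Let \<open>N = 2 ^ l\<close> and consider the graph of disjoint pairs on \<open>G\<close>. A set of at most \<open>(1/2 - c) n\<close>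
  points contains an exponentially small part of any family of size about \<open>N\<close>. Hence all but few edges
  are covered by boundedly many sets \<open>W\<close> of size about \<open>n/2\<close>, in the sense that both ends lie below
  some \<open>W\<close>, and an edge joins two such sets only if they are nearly complementary. This makes the graph
  bipartite up to \<open>o(N\<^sup>2)\<close> edges, with classes \<open>A\<close> and \<open>B\<close>, say.

  Since \<open>|A| + |B| \<le> 3 N\<close>, at most \<open>9/4 N\<^sup>2\<close> pairs produce almost \<open>2 N\<^sup>2\<close> distinct unions, so a
  random pair is disjoint with probability close to \<open>8/9\<close> at least. For each point \<open>i\<close> the unions
  containing \<open>i\<close> force one of the frequencies of \<open>i\<close> in \<open>A\<close> and in \<open>B\<close> to be about \<open>1/3\<close> or more; let \<open>P\<close>
  be the points more frequent in \<open>A\<close> and \<open>Q\<close> the others. A member of \<open>A\<close> that meets \<open>Q\<close> meets a third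
  of \<open>B\<close>, so at most about a third of \<open>A\<close> lies outside \<open>Pow P\<close>, and likewise for \<open>B\<close>. By size,
  \<open>{|P|, |Q|} = {l, l + 1}\<close>. Counting how the unions with a missing trace on \<open>P\<close> or \<open>Q\<close> can be
  produced then bootstraps these constants to \<open>O(\<delta>)\<close>.
\<close>

section \<open>Disjoint pairs and their unions\<close>

definition disjoint_pairs :: "'a set set \<Rightarrow> 'a set set \<Rightarrow> ('a set \<times> 'a set) set" where
  "disjoint_pairs A B = {(x, y) \<in> A \<times> B. x \<inter> y = {}}"

definition disjoint_unions :: "'a set set \<Rightarrow> 'a set set \<Rightarrow> 'a set set" where
  "disjoint_unions A B = (\<lambda>(x, y). x \<union> y) ` disjoint_pairs A B"

lemma disjoint_pairs_subset: "disjoint_pairs A B \<subseteq> A \<times> B"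
  by (auto simp: disjoint_pairs_def)

lemma finite_disjoint_pairs: "finite A \<Longrightarrow> finite B \<Longrightarrow> finite (disjoint_pairs A B)"
  by (rule finite_subset[OF disjoint_pairs_subset]) simp

lemma disjoint_unions_subset: "A \<subseteq> Pow V \<Longrightarrow> B \<subseteq> Pow V \<Longrightarrow> disjoint_unions A B \<subseteq> Pow V"
  by (auto simp: disjoint_unions_def disjoint_pairs_def)

lemma disjoint_unions_commute: "disjoint_unions A B = disjoint_unions B A"
  by (force simp: disjoint_unions_def disjoint_pairs_def image_iff)

text \<open>A member of \<open>T\<close> is either missed by the disjoint unions or produced by a
  disjoint pair, and then it lies in \<open>U\<close>. Later counts only have to exhibit a small
  \<open>U\<close> for a well chosen \<open>T\<close>.\<close>

lemma card_le_missing_plus_cover: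
  assumes "finite V" "T \<subseteq> Pow V" "finite U"
    and cover: "\<And>x y. x \<in> A \<Longrightarrow> y \<in> B \<Longrightarrow> x \<inter> y = {} \<Longrightarrow> x \<union> y \<in> T \<Longrightarrow> x \<union> y \<in> U"
  shows "card T \<le> card (Pow V - disjoint_unions A B) + card U"
proof -
  have "T \<inter> disjoint_unions A B \<subseteq> U"
    using cover by (auto simp: disjoint_unions_def disjoint_pairs_def)
  hence "T \<subseteq> (Pow V - disjoint_unions A B) \<union> U" using assms by auto
  hence "card T \<le> card ((Pow V - disjoint_unions A B) \<union> U)" using assms by (intro card_mono) auto
  also have "\<dots> \<le> card (Pow V - disjoint_unions A B) + card U" by (rule card_Un_le)
  finally show ?thesis .
qed

lemma card_union_image_le:
  assumes "finite A" "finite B"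
  shows "card ((\<lambda>(x, y). x \<union> y) ` (A \<times> B)) \<le> card A * card B"
  using card_image_le[of "A \<times> B"] assms by (simp add: card_cartesian_product)

text \<open>A disjoint union avoids \<open>i\<close> exactly when both parts do, and contains it
  exactly when one part does. The sets avoiding \<open>i\<close> and those containing it are each
  half of \<open>Pow V\<close>.\<close>

lemma coordinate_bounds:
  assumes "finite V" "card V = Suc k" "A \<subseteq> Pow V" "B \<subseteq> Pow V" "i \<in> V"
  shows "2 ^ k \<le> card (Pow V - disjoint_unions A B) + card {x \<in> A. i \<notin> x} * card {y \<in> B. i \<notin> y}"
    and "2 ^ k \<le> card (Pow V - disjoint_unions A B)
           + (card {x \<in> A. i \<in> x} * card {y \<in> B. i \<notin> y} + card {x \<in> A. i \<notin> x} * card {y \<in> B. i \<in> y})"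
proof -
  let ?u = "\<lambda>(x, y). x \<union> y"
  have fin: "finite A" "finite B" using assms by (auto intro: finite_subset)
  have card: "card (Pow (V - {i})) = 2 ^ k" using assms by (simp add: card_Pow)
  have "card (Pow (V - {i})) \<le> card (Pow V - disjoint_unions A B)
      + card (?u ` ({x \<in> A. i \<notin> x} \<times> {y \<in> B. i \<notin> y}))"
  proof (rule card_le_missing_plus_cover)
    fix x y assume "x \<in> A" "y \<in> B" "x \<union> y \<in> Pow (V - {i})"
    hence "(x, y) \<in> {x \<in> A. i \<notin> x} \<times> {y \<in> B. i \<notin> y}" by auto
    thus "x \<union> y \<in> ?u ` ({x \<in> A. i \<notin> x} \<times> {y \<in> B. i \<notin> y})" by (rule rev_image_eqI) simp
  qed (use assms fin in auto)
  also note card_union_image_le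
  finally show "2 ^ k \<le> card (Pow V - disjoint_unions A B) + card {x \<in> A. i \<notin> x} * card {y \<in> B. i \<notin> y}"
    unfolding card using fin by simp
  let ?T = "insert i ` Pow (V - {i})"
  let ?U1 = "?u ` ({x \<in> A. i \<in> x} \<times> {y \<in> B. i \<notin> y})"
  let ?U2 = "?u ` ({x \<in> A. i \<notin> x} \<times> {y \<in> B. i \<in> y})"
  have inj: "inj_on (insert i) (Pow (V - {i}))" by (auto simp: inj_on_def)
  have "card ?T \<le> card (Pow V - disjoint_unions A B) + card (?U1 \<union> ?U2)"
  proof (rule card_le_missing_plus_cover)
    fix x y assume *: "x \<in> A" "y \<in> B" "x \<inter> y = {}" "x \<union> y \<in> ?T"
    show "x \<union> y \<in> ?U1 \<union> ?U2"
    proof (cases "i \<in> x")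
      case True
      hence "(x, y) \<in> {x \<in> A. i \<in> x} \<times> {y \<in> B. i \<notin> y}" using * by auto
      hence "x \<union> y \<in> ?U1" by (rule rev_image_eqI) simp
      thus ?thesis ..
    next
      case False
      hence "(x, y) \<in> {x \<in> A. i \<notin> x} \<times> {y \<in> B. i \<in> y}" using * by auto
      hence "x \<union> y \<in> ?U2" by (rule rev_image_eqI) simp
      thus ?thesis ..
    qed
  qed (use assms fin in auto)
  also have "card (?U1 \<union> ?U2) \<le> card ?U1 + card ?U2" by (rule card_Un_le)
  also have "card ?U1 \<le> card {x \<in> A. i \<in> x} * card {y \<in> B. i \<notin> y}"
    using fin by (intro card_union_image_le) auto
  also have "card ?U2 \<le> card {x \<in> A. i \<notin> x} * card {y \<in> B. i \<in> y}"
    using fin by (intro card_union_image_le) auto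
  finally show "2 ^ k \<le> card (Pow V - disjoint_unions A B)
      + (card {x \<in> A. i \<in> x} * card {y \<in> B. i \<notin> y} + card {x \<in> A. i \<notin> x} * card {y \<in> B. i \<in> y})"
    using card card_image[OF inj] by simp
qed

lemma card_filter_split: "finite A \<Longrightarrow> card {x \<in> A. P x} + card {x \<in> A. \<not> P x} = card A"
  using card_Un_disjoint[of "{x \<in> A. P x}" "{x \<in> A. \<not> P x}"]
  by (simp add: Un_def conj_disj_distribL[symmetric] disjoint_iff)

section \<open>Double counting of pairs, and the cost of intersecting pairs\<close>

lemma card_pairs_lower:
  fixes c :: real
  assumes "finite X" "finite B" "\<And>x. x \<in> X \<Longrightarrow> c \<le> card {y \<in> B. R x y}"
  shows "real (card X) * c \<le> card {(x, y) \<in> X \<times> B. R x y}"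
proof -
  have "{(x, y) \<in> X \<times> B. R x y} = Sigma X (\<lambda>x. {y \<in> B. R x y})" by auto
  hence "real (card {(x, y) \<in> X \<times> B. R x y}) = (\<Sum>x\<in>X. real (card {y \<in> B. R x y}))"
    using assms by simp
  thus ?thesis using sum_bounded_below[of X c "\<lambda>x. real (card {y \<in> B. R x y})"] assms(3) by simp
qed

lemma card_pairs_upper:
  fixes c :: real
  assumes "finite X" "finite B" "\<And>x. x \<in> X \<Longrightarrow> card {y \<in> B. R x y} \<le> c"
  shows "card {(x, y) \<in> X \<times> B. R x y} \<le> real (card X) * c"
proof -
  have "{(x, y) \<in> X \<times> B. R x y} = Sigma X (\<lambda>x. {y \<in> B. R x y})" by auto
  hence "real (card {(x, y) \<in> X \<times> B. R x y}) = (\<Sum>x\<in>X. real (card {y \<in> B. R x y}))"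
    using assms by simp
  thus ?thesis using sum_bounded_above[of X "\<lambda>x. real (card {y \<in> B. R x y})" c] assms(3) by simp
qed

lemma card_pairs_swap: "card {(x, y) \<in> X \<times> Y. R x y} = card {(y, x) \<in> Y \<times> X. R x y}"
  by (rule bij_betw_same_card[of "\<lambda>(x, y). (y, x)"])
    (auto simp: bij_betw_def inj_on_def image_iff)

lemma card_meeting_lower:
  assumes "finite B" "x \<inter> Q \<noteq> {}" "\<And>i. i \<in> Q \<Longrightarrow> (c::real) \<le> card {y \<in> B. i \<in> y}"
  shows "c \<le> card {y \<in> B. x \<inter> y \<noteq> {}}"
proof -
  from assms(2) obtain i where i: "i \<in> x" "i \<in> Q" by auto
  have "card {y \<in> B. i \<in> y} \<le> card {y \<in> B. x \<inter> y \<noteq> {}}"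
    using i assms(1) by (intro card_mono) auto
  thus ?thesis using assms(3)[OF i(2)] by linarith
qed

lemma card_disjoint_pairs_complement:
  assumes "finite A" "finite B"
  shows "card (disjoint_pairs A B) + card {(x, y) \<in> A \<times> B. x \<inter> y \<noteq> {}} = card A * card B"
  using card_filter_split[of "A \<times> B" "\<lambda>(x, y). x \<inter> y = {}"] assms
  unfolding disjoint_pairs_def by (simp add: card_cartesian_product case_prod_unfold mem_Times_iff conj_assoc)

text \<open>Each union uses up at least one disjoint pair, so intersecting pairs must fit into the
  surplus of \<open>card A * card B\<close> over the number of unions.\<close>

lemma card_disjoint_unions_le:
  assumes "finite A" "finite B"
  shows "card (disjoint_unions A B) + card {(x, y) \<in> A \<times> B. x \<inter> y \<noteq> {}} \<le> card A * card B"
proof -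
  have "card (disjoint_unions A B) \<le> card (disjoint_pairs A B)"
    unfolding disjoint_unions_def by (intro card_image_le finite_disjoint_pairs assms)
  thus ?thesis using card_disjoint_pairs_complement[OF assms] by simp
qed

section \<open>The disjointness graph is nearly bipartite\<close>

text \<open>Averaging over \<open>s\<close>-tuples of neighbours: few tuples have a union of size at most \<open>l - d\<close>, so some
  tuple with a large union has many common neighbours, all of which lie in the complement \<open>W\<close>.\<close>

lemma rich_set:
  fixes \<kappa> :: real and G R :: "'a set set"
  assumes V: "finite V" "card V = 2 * l + 1" and G: "G \<subseteq> Pow V" "card G \<le> 3 * 2 ^ l"
    and R: "R \<subseteq> G" and \<kappa>: "0 < \<kappa>"
    and deg: "\<And>x. x \<in> R \<Longrightarrow> \<kappa> * 2 ^ l \<le> card {y \<in> G. x \<inter> y = {}}"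
    and card_R: "\<kappa> * 2 ^ l \<le> card R"
    and large: "3 * 2 ^ l * (2 ^ (2 * l + 1) * (2 ^ (l - d)) ^ s) < \<kappa> * 2 ^ l * (\<kappa> * 2 ^ l) ^ s / 2"
  shows "\<exists>W\<subseteq>V. card W \<le> l + d \<and> \<kappa> * (\<kappa> / 3) ^ s / 2 * 2 ^ l \<le> card (R \<inter> Pow W)"
proof (rule ccontr)
  assume none: "\<not> ?thesis"
  define L where "L = {ys. set ys \<subseteq> G \<and> length ys = s}"
  define Sm where "Sm = {ys \<in> L. card (\<Union>(set ys)) \<le> l - d}"
  define La where "La = {ys \<in> L. \<not> card (\<Union>(set ys)) \<le> l - d}"
  define Dj :: "'a set \<Rightarrow> 'a set list \<Rightarrow> bool" where "Dj x ys \<longleftrightarrow> (\<forall>y\<in>set ys. x \<inter> y = {})" for x ys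
  have finG: "finite G" using G V by (auto intro: finite_subset)
  have finR: "finite R" using R finG by (rule finite_subset)
  have finL: "finite L" unfolding L_def by (rule finite_lists_length_eq[OF finG])
  have finS: "finite Sm" "finite La" using finL by (auto simp: Sm_def La_def)
  have cG: "real (card G) \<le> 3 * 2 ^ l"
  proof -
    have "real (card G) \<le> real (3 * 2 ^ l)" using G(2) by (simp only: of_nat_le_iff)
    thus ?thesis by simp
  qed
  have cR: "real (card R) \<le> 3 * 2 ^ l" using cG card_mono[OF finG R] by linarith
  have "real (card R) * (\<kappa> * 2 ^ l) ^ s \<le> card {(x, ys) \<in> R \<times> L. Dj x ys}"
  proof (rule card_pairs_lower[OF finR finL])
    fix x assume x: "x \<in> R"
    let ?N = "{y \<in> G. x \<inter> y = {}}"
    have "{ys \<in> L. Dj x ys} = {ys. set ys \<subseteq> ?N \<and> length ys = s}"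
      by (auto simp: L_def Dj_def)
    hence "card {ys \<in> L. Dj x ys} = card ?N ^ s" using finG by (simp add: card_lists_length_eq)
    moreover have "(\<kappa> * 2 ^ l) ^ s \<le> real (card ?N) ^ s" using deg[OF x] \<kappa> by (intro power_mono) auto
    ultimately show "(\<kappa> * 2 ^ l) ^ s \<le> card {ys \<in> L. Dj x ys}" by simp
  qed
  moreover have "\<kappa> * 2 ^ l * (\<kappa> * 2 ^ l) ^ s \<le> real (card R) * (\<kappa> * 2 ^ l) ^ s"
    using card_R \<kappa> by (intro mult_right_mono) auto
  moreover have "card {(x, ys) \<in> R \<times> L. Dj x ys} \<le> card R * card Sm + card {(ys, x) \<in> La \<times> R. Dj x ys}"
  proof -
    have "{(x, ys) \<in> R \<times> L. Dj x ys} \<subseteq> R \<times> Sm \<union> {(x, ys) \<in> R \<times> La. Dj x ys}"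
      by (auto simp: Sm_def La_def)
    moreover have "finite (R \<times> Sm \<union> {(x, ys) \<in> R \<times> La. Dj x ys})"
      by (rule finite_subset[of _ "R \<times> L"]) (use finR finL in \<open>auto simp: Sm_def La_def\<close>)
    ultimately have "card {(x, ys) \<in> R \<times> L. Dj x ys} \<le> card (R \<times> Sm \<union> {(x, ys) \<in> R \<times> La. Dj x ys})"
      by (intro card_mono)
    also have "\<dots> \<le> card (R \<times> Sm) + card {(x, ys) \<in> R \<times> La. Dj x ys}" by (rule card_Un_le)
    finally show ?thesis by (simp only: card_cartesian_product card_pairs_swap[of R La Dj])
  qed
  moreover have "card {(ys, x) \<in> La \<times> R. Dj x ys} \<le> real (card La) * (\<kappa> * (\<kappa> / 3) ^ s / 2 * 2 ^ l)"
  proof (rule card_pairs_upper[OF finS(2) finR])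
    fix ys assume ys: "ys \<in> La"
    let ?W = "V - \<Union>(set ys)"
    have sub: "\<Union>(set ys) \<subseteq> V" using ys G(1) by (auto simp: La_def L_def)
    \<comment> \<open>The strict inequality \<open>l - d < card (\<Union>(set ys))\<close> absorbs
      the odd point of \<open>V\<close>.\<close>
    have "card ?W = 2 * l + 1 - card (\<Union>(set ys))"
      using sub V by (simp add: card_Diff_subset finite_subset)
    hence "card ?W \<le> l + d" using ys by (auto simp: La_def)
    hence "card (R \<inter> Pow ?W) \<le> \<kappa> * (\<kappa> / 3) ^ s / 2 * 2 ^ l" using none by force
    moreover have "{x \<in> R. Dj x ys} \<subseteq> R \<inter> Pow ?W" using R G(1) by (auto simp: Dj_def)
    hence "card {x \<in> R. Dj x ys} \<le> card (R \<inter> Pow ?W)" using finR by (intro card_mono) auto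
    ultimately show "card {x \<in> R. Dj x ys} \<le> \<kappa> * (\<kappa> / 3) ^ s / 2 * 2 ^ l" by linarith
  qed
  \<comment> \<open>The threshold for \<open>card (R \<inter> Pow W)\<close> is tuned to this step:
    there are at most \<open>(3 * 2 ^ l) ^ s\<close> tuples with a large union, so they account for
    at most half of the lower bound on incidences.\<close>
  moreover have "real (card La) * (\<kappa> * (\<kappa> / 3) ^ s / 2 * 2 ^ l) \<le> \<kappa> * 2 ^ l * (\<kappa> * 2 ^ l) ^ s / 2"
  proof -
    have "card La \<le> card L" using finL by (intro card_mono) (auto simp: La_def)
    also have "card L = card G ^ s" unfolding L_def by (rule card_lists_length_eq[OF finG])
    finally have "real (card La) \<le> real (card G) ^ s" by (metis of_nat_le_iff of_nat_power)
    also have "\<dots> \<le> (3 * 2 ^ l) ^ s" using cG by (intro power_mono) auto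
    finally have "real (card La) * (\<kappa> * (\<kappa> / 3) ^ s / 2 * 2 ^ l) \<le> (3 * 2 ^ l) ^ s * (\<kappa> * (\<kappa> / 3) ^ s / 2 * 2 ^ l)"
      using \<kappa> by (intro mult_right_mono) auto
    also have "\<dots> = \<kappa> * 2 ^ l * (\<kappa> * 2 ^ l) ^ s / 2"
      by (simp add: power_mult_distrib power_divide)
    finally show ?thesis .
  qed
  \<comment> \<open>Union bound over the at most \<open>2 ^ (2 * l + 1)\<close> possible small
    unions \<open>W\<close> of a tuple, all of whose entries lie in \<open>Pow W\<close>.\<close>
  moreover have "card R * card Sm \<le> 3 * 2 ^ l * ((2::real) ^ (2 * l + 1) * (2 ^ (l - d)) ^ s)"
  proof -
    define \<W> where "\<W> = {W \<in> Pow V. card W \<le> l - d}"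
    have fW: "finite \<W>" using V by (simp add: \<W>_def)
    have "Sm \<subseteq> (\<Union>W\<in>\<W>. {ys. set ys \<subseteq> G \<inter> Pow W \<and> length ys = s})"
    proof
      fix ys assume ys: "ys \<in> Sm"
      hence "\<Union>(set ys) \<in> \<W>" using G(1) by (auto simp: Sm_def L_def \<W>_def)
      moreover have "ys \<in> {zs. set zs \<subseteq> G \<inter> Pow (\<Union>(set ys)) \<and> length zs = s}"
        using ys by (auto simp: Sm_def L_def)
      ultimately show "ys \<in> (\<Union>W\<in>\<W>. {ys. set ys \<subseteq> G \<inter> Pow W \<and> length ys = s})" by blast
    qed
    moreover have "finite {ys. set ys \<subseteq> G \<inter> Pow W \<and> length ys = s}" for W
      using finG by (intro finite_lists_length_eq) auto
    ultimately have "card Sm \<le> card (\<Union>W\<in>\<W>. {ys. set ys \<subseteq> G \<inter> Pow W \<and> length ys = s})"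
      using fW by (intro card_mono) auto
    also have "\<dots> \<le> (\<Sum>W\<in>\<W>. card {ys. set ys \<subseteq> G \<inter> Pow W \<and> length ys = s})"
      by (rule card_UN_le[OF fW])
    also have "\<dots> \<le> (\<Sum>W\<in>\<W>. (2 ^ (l - d)) ^ s)"
    proof (rule sum_mono)
      fix W assume W: "W \<in> \<W>"
      have finW: "finite W" using W V by (auto simp: \<W>_def intro: finite_subset)
      have "card {ys. set ys \<subseteq> G \<inter> Pow W \<and> length ys = s} = card (G \<inter> Pow W) ^ s"
        using finG by (intro card_lists_length_eq) auto
      also have "card (G \<inter> Pow W) \<le> card (Pow W)" using finW by (intro card_mono) auto
      also have "card (Pow W) \<le> 2 ^ (l - d)" using W finW by (simp add: card_Pow \<W>_def)
      finally show "card {ys. set ys \<subseteq> G \<inter> Pow W \<and> length ys = s} \<le> (2 ^ (l - d)) ^ s"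
        by (simp add: power_mono)
    qed
    also have "\<dots> = card \<W> * (2 ^ (l - d)) ^ s" by simp
    also have "card \<W> \<le> card (Pow V)" using V by (intro card_mono) (auto simp: \<W>_def)
    also have "card (Pow V) = 2 ^ (2 * l + 1)" using V by (simp add: card_Pow)
    finally have "card Sm \<le> 2 ^ (2 * l + 1) * (2 ^ (l - d)) ^ s" by simp
    hence "real (card Sm) \<le> real (2 ^ (2 * l + 1) * (2 ^ (l - d)) ^ s)" by (simp only: of_nat_le_iff)
    also have "\<dots> = 2 ^ (2 * l + 1) * (2 ^ (l - d)) ^ s" by simp
    finally have "real (card R) * real (card Sm) \<le> 3 * 2 ^ l * (2 ^ (2 * l + 1) * (2 ^ (l - d)) ^ s)"
      using cR by (intro mult_mono) auto
    thus ?thesis by simp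
  qed
  ultimately show False using large by linarith
qed

text \<open>Greedy choice: as long as at least \<open>c\<close> members are uncovered, some
  \<open>Pow W\<close> removes at least \<open>\<eta>\<close> of them. Charging each chosen set with
  the members it removes bounds the number of choices.\<close>

lemma few_sets_cover:
  fixes c \<eta> :: real
  assumes rich: "\<And>R. R \<subseteq> R0 \<Longrightarrow> c \<le> card R \<Longrightarrow> \<exists>W. P W \<and> \<eta> \<le> card (R \<inter> Pow W)"
    and "0 < \<eta>" "0 < c" "finite R" "R \<subseteq> R0"
  shows "\<exists>\<W>. finite \<W> \<and> (\<forall>W\<in>\<W>. P W) \<and> card \<W> * \<eta> \<le> card R \<and> card {x \<in> R. \<forall>W\<in>\<W>. \<not> x \<subseteq> W} < c"
  using assms(4,5)
proof (induction R rule: measure_induct_rule[of card])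
  case (less R)
  show ?case
  proof (cases "c \<le> card R")
    case False
    thus ?thesis by (intro exI[of _ "{}"]) auto
  next
    case True
    then obtain W where W: "P W" "\<eta> \<le> card (R \<inter> Pow W)" using rich less.prems by blast
    define R' where "R' = R - Pow W"
    have card: "card R = card (R \<inter> Pow W) + card R'"
      unfolding R'_def using less.prems by (metis card_Int_Diff)
    hence "card R' < card R" using W \<open>0 < \<eta>\<close> by auto
    moreover have "finite R'" "R' \<subseteq> R0" using less.prems by (auto simp: R'_def)
    ultimately obtain \<W> where \<W>: "finite \<W>" "\<forall>W\<in>\<W>. P W" "card \<W> * \<eta> \<le> card R'"
      "card {x \<in> R'. \<forall>W\<in>\<W>. \<not> x \<subseteq> W} < c" using less.IH by blast
    have "card (insert W \<W>) \<le> card \<W> + 1" using \<W>(1) by (simp add: card_insert_if)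
    hence "real (card (insert W \<W>)) * \<eta> \<le> (card \<W> + 1) * \<eta>"
      using \<open>0 < \<eta>\<close> by (intro mult_right_mono) auto
    also have "\<dots> \<le> card R" using \<W>(3) W(2) card by (simp add: algebra_simps)
    finally have "card (insert W \<W>) * \<eta> \<le> card R" .
    moreover have "{x \<in> R. \<forall>U\<in>insert W \<W>. \<not> x \<subseteq> U} = {x \<in> R'. \<forall>W\<in>\<W>. \<not> x \<subseteq> W}"
      by (auto simp: R'_def)
    ultimately show ?thesis using \<W> W(1) by (intro exI[of _ "insert W \<W>"]) auto
  qed
qed

section \<open>Counting disjoint pairs below two given sets\<close>

lemma card_disjoint_pairs_Pow_self:
  assumes "finite C" shows "card (disjoint_pairs (Pow C) (Pow C)) = 3 ^ card C"
proof -
  have "disjoint_pairs (Pow C) (Pow C) = Sigma (Pow C) (\<lambda>x. Pow (C - x))"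
    by (auto simp: disjoint_pairs_def)
  hence "card (disjoint_pairs (Pow C) (Pow C)) = (\<Sum>x\<in>Pow C. 2 ^ card (C - x))"
    using assms by (simp add: card_Pow)
  also have "\<dots> = (\<Prod>c\<in>C. 1 + 2)" using prod_add[OF assms, of "\<lambda>_. 1" "\<lambda>_. 2::nat"] by simp
  finally show ?thesis by (simp add: numeral_3_eq_3)
qed

text \<open>A common point of \<open>W\<close> and \<open>W'\<close> may go to \<open>x\<close>, to
  \<open>y\<close> or to neither: three choices. A point of only one of them has two
  choices.\<close>

lemma card_disjoint_pairs_Pow_le:
  assumes "finite W" "finite W'"
  shows "card (disjoint_pairs (Pow W) (Pow W')) \<le> 3 ^ card (W \<inter> W') * (2 ^ card (W - W') * 2 ^ card (W' - W))"
proof -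
  let ?C = "W \<inter> W'"
  let ?f = "\<lambda>(x, y). ((x \<inter> ?C, y \<inter> ?C), (x - W', y - W))"
  let ?T = "disjoint_pairs (Pow ?C) (Pow ?C) \<times> (Pow (W - W') \<times> Pow (W' - W))"
  have "inj_on ?f (disjoint_pairs (Pow W) (Pow W'))"
  proof (rule inj_onI, clarify)
    fix x y x' y'
    assume "(x, y) \<in> disjoint_pairs (Pow W) (Pow W')" "(x', y') \<in> disjoint_pairs (Pow W) (Pow W')"
    hence *: "x \<subseteq> W" "y \<subseteq> W'" "x' \<subseteq> W" "y' \<subseteq> W'" by (auto simp: disjoint_pairs_def)
    assume eq: "x \<inter> ?C = x' \<inter> ?C" "y \<inter> ?C = y' \<inter> ?C" "x - W' = x' - W'" "y - W = y' - W"
    have "x = (x \<inter> ?C) \<union> (x - W')" "x' = (x' \<inter> ?C) \<union> (x' - W')"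
      "y = (y \<inter> ?C) \<union> (y - W)" "y' = (y' \<inter> ?C) \<union> (y' - W)" using * by auto
    thus "x = x' \<and> y = y'" using eq by metis
  qed
  moreover have "?f ` disjoint_pairs (Pow W) (Pow W') \<subseteq> ?T" by (auto simp: disjoint_pairs_def)
  moreover have "finite ?T" using assms by (auto intro: finite_disjoint_pairs)
  ultimately have "card (disjoint_pairs (Pow W) (Pow W')) \<le> card ?T" by (rule card_inj_on_le)
  also have "\<dots> = 3 ^ card ?C * (2 ^ card (W - W') * 2 ^ card (W' - W))"
    using assms by (simp add: card_cartesian_product card_disjoint_pairs_Pow_self card_Pow del: Pow_Int_eq)
  finally show ?thesis .
qed

text \<open>Among all pairs, each common point keeps a fraction 3/4. The overlap
  \<open>6 * d\<close> is large enough for this to beat the factor \<open>4 ^ d\<close> caused by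
  sizes up to \<open>l + d\<close>, because \<open>4 * (3/4) ^ 6 < 1\<close>.\<close>

lemma card_disjoint_pairs_Pow_overlap:
  assumes "finite W" "finite W'" "card W \<le> l + d" "card W' \<le> l + d" "6 * d \<le> card (W \<inter> W')"
  shows "card (disjoint_pairs (Pow W) (Pow W')) \<le> 2 ^ (2 * l) * (4 * (3/4) ^ 6 :: real) ^ d"
proof -
  let ?c = "card (W \<inter> W')"
  have card: "card W = card (W - W') + ?c" "card W' = card (W' - W) + ?c"
    using assms by (metis Int_commute add.commute card_Int_Diff)+
  have "real (card (disjoint_pairs (Pow W) (Pow W'))) \<le> real (3 ^ ?c * (2 ^ card (W - W') * 2 ^ card (W' - W)))"
    using card_disjoint_pairs_Pow_le[OF assms(1,2)] by (simp only: of_nat_le_iff)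
  also have "\<dots> = 3 ^ ?c * 2 ^ (card (W - W') + card (W' - W))" by (simp add: power_add)
  also have "\<dots> = (3/4) ^ ?c * 2 ^ (card W + card W')"
  proof -
    have "(4::real) ^ ?c = 2 ^ ?c * 2 ^ ?c" by (simp flip: power_mult_distrib)
    thus ?thesis unfolding card by (simp add: power_add power_divide)
  qed
  also have "\<dots> \<le> (3/4) ^ (6 * d) * 2 ^ (2 * l + 2 * d)"
    using assms by (intro mult_mono power_decreasing power_increasing) auto
  also have "\<dots> = 2 ^ (2 * l) * (4 * (3/4) ^ 6) ^ d"
    by (simp only: power_add power_mult power_mult_distrib) simp
  finally show ?thesis .
qed


text \<open>If \<open>x\<close> and \<open>y\<close> are disjoint and covered by \<open>W\<close> and \<open>W'\<close>, then typically \<open>W'\<close> is almost the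
  complement of \<open>W\<close>, so a random point \<open>k\<close> of \<open>V\<close> rarely lies in both or in neither. Colouring \<open>x\<close>
  according to whether \<open>k \<in> W\<close> therefore leaves few monochromatic disjoint pairs.\<close>

lemma colouring_from_cover:
  fixes c \<epsilon> :: real and G :: "'a set set"
  assumes V: "finite V" "card V = 2 * l + 1" and G: "G \<subseteq> Pow V" "card G \<le> 3 * 2 ^ l"
    and \<W>: "finite \<W>" "\<And>W. W \<in> \<W> \<Longrightarrow> W \<subseteq> V \<and> card W \<le> l + d"
    and uncovered: "card {(x, y) \<in> G \<times> G. x \<inter> y = {} \<and> (\<forall>W\<in>\<W>. \<not> x \<subseteq> W)} \<le> \<epsilon>"
    and c: "126 * real d * 2 ^ (2 * l) < real (2 * l + 1) * c"
  shows "\<exists>A\<subseteq>G. card {(x, y) \<in> G \<times> G. x \<inter> y = {} \<and> (x \<in> A \<longleftrightarrow> y \<in> A)}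
    \<le> 2 * \<epsilon> + 2 * (real (card \<W>) * 2 ^ (l - d) * (3 * 2 ^ l))
       + real (card \<W>) ^ 2 * (2 ^ (2 * l) * (4 * (3/4) ^ 6) ^ d) + c"
proof -
  define q :: real where "q = 4 * (3/4) ^ 6"
  define U where "U = {x \<in> G. \<exists>W\<in>\<W>. x \<subseteq> W}"
  have "\<forall>x\<in>U. \<exists>W. W \<in> \<W> \<and> x \<subseteq> W" by (auto simp: U_def)
  then obtain \<phi> where \<phi>: "\<And>x. x \<in> U \<Longrightarrow> \<phi> x \<in> \<W>" "\<And>x. x \<in> U \<Longrightarrow> x \<subseteq> \<phi> x"
    by (metis (no_types, lifting))
  define E where "E = disjoint_pairs G G"
  have finG: "finite G" using G V by (auto intro: finite_subset)
  have finE: "finite E" unfolding E_def by (rule finite_disjoint_pairs[OF finG finG])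
  have finW: "finite W" if "W \<in> \<W>" for W using \<W>(2)[OF that] V(1) by (auto intro: finite_subset)
  \<comment> \<open>Exceptional disjoint pairs: uncovered first end (\<open>E1\<close>), too small a
    covering set of the first end (\<open>E2\<close>), large overlap of the covering sets
    (\<open>E3\<close>). Reflections of \<open>E1\<close> and \<open>E2\<close> later handle the
    second end. In \<open>D\<close> the two covering sets are nearly complementary.\<close>
  define E1 E2 where "E1 = {(x, y) \<in> G \<times> G. x \<inter> y = {} \<and> (\<forall>W\<in>\<W>. \<not> x \<subseteq> W)}"
    and "E2 = {(x, y) \<in> E. x \<in> U \<and> card (\<phi> x) \<le> l - d}"
  define E3 where "E3 = {(x, y) \<in> E. x \<in> U \<and> y \<in> U \<and> 6 * d \<le> card (\<phi> x \<inter> \<phi> y)}"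
  define D where "D = {(x, y) \<in> E. x \<in> U \<and> y \<in> U \<and> \<not> card (\<phi> x) \<le> l - d \<and> \<not> card (\<phi> y) \<le> l - d
      \<and> \<not> 6 * d \<le> card (\<phi> x \<inter> \<phi> y)}"
  have fin: "finite E1" "finite E2" "finite E3" "finite D"
    by (rule finite_subset[OF _ finE], force simp: E1_def E2_def E3_def D_def E_def disjoint_pairs_def)+
  have cE1: "card E1 \<le> \<epsilon>" using uncovered by (simp add: E1_def)
  have cE2: "card E2 \<le> card \<W> * 2 ^ (l - d) * (3 * 2 ^ l)"
  proof -
    define \<W>' where "\<W>' = {W \<in> \<W>. card W \<le> l - d}"
    have fW: "finite \<W>'" using \<W>(1) by (simp add: \<W>'_def)
    have "E2 \<subseteq> (\<Union>W\<in>\<W>'. Pow W \<times> G)"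
      using \<phi> by (force simp: E2_def E_def disjoint_pairs_def \<W>'_def)
    moreover have "finite (\<Union>W\<in>\<W>'. Pow W \<times> G)" using fW finW finG by (auto simp: \<W>'_def)
    ultimately have "card E2 \<le> card (\<Union>W\<in>\<W>'. Pow W \<times> G)" by (intro card_mono)
    also have "\<dots> \<le> (\<Sum>W\<in>\<W>'. card (Pow W \<times> G))" by (rule card_UN_le[OF fW])
    also have "\<dots> \<le> (\<Sum>W\<in>\<W>'. 2 ^ (l - d) * (3 * 2 ^ l))"
    proof (rule sum_mono)
      fix W assume "W \<in> \<W>'"
      hence "finite W" "card W \<le> l - d" using finW by (auto simp: \<W>'_def)
      thus "card (Pow W \<times> G) \<le> 2 ^ (l - d) * (3 * 2 ^ l)"
        unfolding card_cartesian_product using G(2) by (intro mult_mono) (auto simp: card_Pow)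
    qed
    also have "\<dots> = card \<W>' * (2 ^ (l - d) * (3 * 2 ^ l))" by simp
    also have "card \<W>' \<le> card \<W>" using \<W>(1) by (intro card_mono) (auto simp: \<W>'_def)
    finally show ?thesis by (simp add: mult.assoc)
  qed
  have cE3: "card E3 \<le> real (card \<W>) ^ 2 * (2 ^ (2 * l) * q ^ d)"
  proof -
    define I where "I = {(W, W') \<in> \<W> \<times> \<W>. 6 * d \<le> card (W \<inter> W')}"
    have fI: "finite I" by (rule finite_subset[of _ "\<W> \<times> \<W>"]) (use \<W>(1) in \<open>auto simp: I_def\<close>)
    have "E3 \<subseteq> (\<Union>(W, W')\<in>I. disjoint_pairs (Pow W) (Pow W'))"
    proof
      fix p assume "p \<in> E3"
      then obtain x y where p: "p = (x, y)" "x \<inter> y = {}" "x \<in> U" "y \<in> U" "6 * d \<le> card (\<phi> x \<inter> \<phi> y)"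
        by (auto simp: E3_def E_def disjoint_pairs_def)
      hence "(\<phi> x, \<phi> y) \<in> I" "p \<in> disjoint_pairs (Pow (\<phi> x)) (Pow (\<phi> y))"
        using \<phi> by (auto simp: I_def disjoint_pairs_def)
      thus "p \<in> (\<Union>(W, W')\<in>I. disjoint_pairs (Pow W) (Pow W'))" by blast
    qed
    moreover have "finite (\<Union>(W, W')\<in>I. disjoint_pairs (Pow W) (Pow W'))"
      using fI finW by (auto simp: I_def intro!: finite_disjoint_pairs)
    ultimately have "card E3 \<le> card (\<Union>(W, W')\<in>I. disjoint_pairs (Pow W) (Pow W'))" by (intro card_mono)
    also have "\<dots> \<le> (\<Sum>(W, W')\<in>I. card (disjoint_pairs (Pow W) (Pow W')))"
      using card_UN_le[OF fI, of "\<lambda>(W, W'). disjoint_pairs (Pow W) (Pow W')"]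
      by (simp add: case_prod_unfold)
    finally have "real (card E3) \<le> (\<Sum>(W, W')\<in>I. real (card (disjoint_pairs (Pow W) (Pow W'))))"
      unfolding case_prod_unfold of_nat_sum[symmetric] by (simp only: of_nat_le_iff)
    also have "\<dots> \<le> (\<Sum>(W, W')\<in>I. 2 ^ (2 * l) * q ^ d)"
    proof (rule sum_mono, clarify)
      fix W W' assume "(W, W') \<in> I"
      thus "real (card (disjoint_pairs (Pow W) (Pow W'))) \<le> 2 ^ (2 * l) * q ^ d"
        unfolding q_def using \<W>(2) finW by (intro card_disjoint_pairs_Pow_overlap) (auto simp: I_def)
    qed
    also have "\<dots> = card I * (2 ^ (2 * l) * q ^ d)" by simp
    also have "\<dots> \<le> real (card \<W>) ^ 2 * (2 ^ (2 * l) * q ^ d)"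
    proof (rule mult_right_mono)
      have "card I \<le> card (\<W> \<times> \<W>)" using \<W>(1) by (intro card_mono) (auto simp: I_def)
      hence "card I \<le> card \<W> ^ 2" by (simp add: card_cartesian_product power2_eq_square)
      thus "real (card I) \<le> real (card \<W>) ^ 2" by (metis of_nat_le_iff of_nat_power)
    qed (simp add: q_def)
    finally show ?thesis .
  qed
  \<comment> \<open>Averaging over \<open>k\<close>: for a pair in \<open>D\<close>, fewer than
    \<open>6 * d\<close> points lie in both covering sets and fewer than \<open>8 * d\<close> in
    neither, so at most \<open>14 * d\<close> points are bad. With
    \<open>card D \<le> 9 * 2 ^ (2 * l)\<close> this explains 126 = 9 * 14.\<close>
  have "\<exists>k\<in>V. card {p \<in> D. k \<in> \<phi> (fst p) \<longleftrightarrow> k \<in> \<phi> (snd p)} \<le> c"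
  proof (rule ccontr)
    assume n: "\<not> ?thesis"
    have "real (card V) * c \<le> card {(k, p) \<in> V \<times> D. k \<in> \<phi> (fst p) \<longleftrightarrow> k \<in> \<phi> (snd p)}"
    proof (rule card_pairs_lower[OF V(1) fin(4)])
      fix k assume "k \<in> V"
      thus "c \<le> card {p \<in> D. k \<in> \<phi> (fst p) \<longleftrightarrow> k \<in> \<phi> (snd p)}" using n by force
    qed
    also have "card {(k, p) \<in> V \<times> D. k \<in> \<phi> (fst p) \<longleftrightarrow> k \<in> \<phi> (snd p)}
        = card {(p, k) \<in> D \<times> V. k \<in> \<phi> (fst p) \<longleftrightarrow> k \<in> \<phi> (snd p)}" by (rule card_pairs_swap)
    also have "real \<dots> \<le> card D * real (14 * d)"
    proof (rule card_pairs_upper[OF fin(4) V(1)])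
      fix p assume p: "p \<in> D"
      define W W' where "W = \<phi> (fst p)" and "W' = \<phi> (snd p)"
      have U: "fst p \<in> U" "snd p \<in> U" using p by (auto simp: D_def)
      have w: "W \<subseteq> V" "W' \<subseteq> V" "\<not> card W \<le> l - d" "\<not> card W' \<le> l - d" "\<not> 6 * d \<le> card (W \<inter> W')"
        using p \<W>(2)[OF \<phi>(1)[OF U(1)]] \<W>(2)[OF \<phi>(1)[OF U(2)]] by (auto simp: D_def W_def W'_def)
      have fW: "finite W" "finite W'" using w V(1) by (auto intro: finite_subset)
      have "{k \<in> V. k \<in> W \<longleftrightarrow> k \<in> W'} \<subseteq> (W \<inter> W') \<union> (V - (W \<union> W'))" by auto
      hence "card {k \<in> V. k \<in> W \<longleftrightarrow> k \<in> W'} \<le> card ((W \<inter> W') \<union> (V - (W \<union> W')))"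
        using fW V(1) by (intro card_mono) auto
      also have "\<dots> \<le> card (W \<inter> W') + card (V - (W \<union> W'))" by (rule card_Un_le)
      also have "card (V - (W \<union> W')) = 2 * l + 1 - card (W \<union> W')"
        using w fW V by (simp add: card_Diff_subset)
      finally have "card {k \<in> V. k \<in> W \<longleftrightarrow> k \<in> W'} \<le> 14 * d"
        using card_Un_Int[OF fW] w by linarith
      thus "card {k \<in> V. k \<in> \<phi> (fst p) \<longleftrightarrow> k \<in> \<phi> (snd p)} \<le> real (14 * d)"
        unfolding W_def W'_def by (simp only: of_nat_le_iff)
    qed
    also have "card D * real (14 * d) \<le> (9 * 2 ^ (2 * l)) * real (14 * d)"
    proof (rule mult_right_mono)
      have "card D \<le> card (G \<times> G)"
        using finG by (intro card_mono) (auto simp: D_def E_def disjoint_pairs_def)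
      also have "\<dots> \<le> (3 * 2 ^ l) * (3 * 2 ^ l)"
        unfolding card_cartesian_product using G(2) by (intro mult_mono) auto
      also have "\<dots> = 9 * 2 ^ (2 * l)" by (simp add: mult_2 power_add)
      finally have "real (card D) \<le> real (9 * 2 ^ (2 * l))" by (simp only: of_nat_le_iff)
      thus "real (card D) \<le> 9 * 2 ^ (2 * l)" by simp
    qed simp
    finally show False using c V(2) by (simp add: algebra_simps)
  qed
  then obtain k where k: "k \<in> V" "card {p \<in> D. k \<in> \<phi> (fst p) \<longleftrightarrow> k \<in> \<phi> (snd p)} \<le> c" by blast
  define F where "F = {p \<in> D. k \<in> \<phi> (fst p) \<longleftrightarrow> k \<in> \<phi> (snd p)}"
  \<comment> \<open>Outside \<open>U\<close> the value of \<open>\<phi>\<close> is arbitrary;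
    disjoint pairs with such an end are counted in \<open>E1\<close> or its reflection.\<close>
  define A where "A = {x \<in> G. k \<in> \<phi> x}"
  have finF: "finite F" using fin by (simp add: F_def)
  have "{(x, y) \<in> G \<times> G. x \<inter> y = {} \<and> (x \<in> A \<longleftrightarrow> y \<in> A)}
      \<subseteq> ((E1 \<union> prod.swap ` E1) \<union> (E2 \<union> prod.swap ` E2)) \<union> (E3 \<union> F)" (is "?M \<subseteq> ?R")
  proof (rule subsetI, rule ccontr)
    fix p assume "p \<in> ?M" and n: "p \<notin> ?R"
    then obtain x y where p: "p = (x, y)" and *: "x \<in> G" "y \<in> G" "x \<inter> y = {}" "x \<in> A \<longleftrightarrow> y \<in> A"
      by auto
    have swap: "(y, x) \<notin> X" if "p \<notin> prod.swap ` X" for X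
      using that unfolding p by (metis image_eqI swap_simp)
    have n1: "(x, y) \<notin> E1" "(y, x) \<notin> E1" "(x, y) \<notin> E2" "(y, x) \<notin> E2" "(x, y) \<notin> E3" "(x, y) \<notin> F"
      using n swap unfolding p by auto
    have **: "y \<inter> x = {}" using * by auto
    have E: "(x, y) \<in> E" "(y, x) \<in> E" using * ** by (auto simp: E_def disjoint_pairs_def)
    have U: "x \<in> U" "y \<in> U" using n1 * ** by (auto simp: E1_def U_def)
    hence "(x, y) \<in> D" using n1 E by (auto simp: D_def E2_def E3_def)
    hence "(x, y) \<in> F" using * by (auto simp: F_def A_def)
    thus False using n1 by simp
  qed
  moreover have "finite ?R" using fin finF by simp
  ultimately have "card ?M \<le> card ?R" by (intro card_mono)
  also have "\<dots> \<le> ((card E1 + card E1) + (card E2 + card E2)) + (card E3 + card F)"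
    using fin by (intro order_trans[OF card_Un_le] add_mono card_image_le order_refl)
  finally have "real (card ?M) \<le> real (((card E1 + card E1) + (card E2 + card E2)) + (card E3 + card F))"
    by (simp only: of_nat_le_iff)
  also have "\<dots> = 2 * real (card E1) + 2 * real (card E2) + real (card E3) + real (card F)" by simp
  also have "real (card E2) \<le> real (card \<W> * 2 ^ (l - d) * (3 * 2 ^ l))"
    using cE2 by (simp only: of_nat_le_iff)
  finally have "real (card ?M) \<le> 2 * \<epsilon> + 2 * (real (card \<W>) * 2 ^ (l - d) * (3 * 2 ^ l))
       + real (card \<W>) ^ 2 * (2 ^ (2 * l) * q ^ d) + c"
    using cE1 cE3 k(2) by (simp add: F_def)
  moreover have "A \<subseteq> G" by (auto simp: A_def)
  ultimately show ?thesis unfolding q_def by blast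
qed

text \<open>Tuples of length \<open>3 * m\<close> with entries below a set of size
  \<open>l - l div m\<close> are rarer by a factor of about \<open>8 ^ l\<close>, which outweighs
  the \<open>2 * 4 ^ l\<close> choices of that set. Rounding in \<open>l div m\<close> costs the
  factor \<open>8 ^ m\<close>.\<close>

lemma tuple_count_bound:
  fixes \<kappa> :: real
  assumes \<kappa>: "0 < \<kappa>" and m: "0 < m" and l: "12 * 8 ^ m < \<kappa> ^ (3 * m + 1) * 2 ^ l"
  shows "3 * 2 ^ l * (2 ^ (2 * l + 1) * (2 ^ (l - l div m)) ^ (3 * m))
    < \<kappa> * 2 ^ l * (\<kappa> * 2 ^ l) ^ (3 * m) / 2"
proof -
  define d s where "d = l div m" and "s = 3 * m"
  define X Y :: real where "X = (2 ^ d) ^ s" and "Y = (2 ^ (l - d)) ^ s"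
  have "d \<le> l" by (simp add: d_def)
  hence XY: "X * Y = (2 ^ l) ^ s"
    by (simp add: X_def Y_def flip: power_mult_distrib power_add)
  have "l < m * (d + 1)" unfolding d_def using m by (metis add.commute dividend_less_times_div mult_Suc_right plus_1_eq_Suc)
  hence "(2::real) ^ (3 * l) \<le> 2 ^ (3 * (m * (d + 1)))" by (intro power_increasing) auto
  also have "\<dots> = 2 ^ (3 * m) * X"
    by (simp add: X_def s_def algebra_simps flip: power_mult power_add)
  finally have eight: "(8::real) ^ l \<le> 8 ^ m * X" by (simp add: power_mult)
  have "12 * 8 ^ m * (4::real) ^ l < \<kappa> ^ (s + 1) * 2 ^ l * 4 ^ l"
    using l by (simp add: s_def)
  also have "\<dots> = \<kappa> ^ (s + 1) * 8 ^ l" by (simp add: mult.assoc flip: power_mult_distrib)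
  also have "\<dots> \<le> \<kappa> ^ (s + 1) * (8 ^ m * X)" using eight \<kappa> by (intro mult_left_mono) auto
  finally have "12 * 4 ^ l < \<kappa> ^ (s + 1) * X" by (simp add: mult_ac)
  moreover have "0 < 2 ^ l * Y / 2" by (simp add: Y_def)
  ultimately have "12 * 4 ^ l * (2 ^ l * Y / 2) < \<kappa> ^ (s + 1) * X * (2 ^ l * Y / 2)"
    by (rule mult_strict_right_mono)
  moreover have "\<kappa> ^ (s + 1) * X * (2 ^ l * Y / 2) = \<kappa> * 2 ^ l * (\<kappa> * 2 ^ l) ^ s / 2"
    using XY by (simp add: power_mult_distrib algebra_simps)
  moreover have "12 * 4 ^ l * (2 ^ l * Y / 2) = 3 * 2 ^ l * (2 ^ (2 * l + 1) * Y)"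
    by (simp add: power_mult)
  ultimately show ?thesis by (simp only: Y_def s_def d_def)
qed

lemma nearly_bipartite:
  fixes \<epsilon> :: real
  assumes \<epsilon>: "0 < \<epsilon>"
  shows "\<exists>l0. \<forall>l\<ge>l0. \<forall>G :: 'a set set. \<forall>V. finite V \<longrightarrow> card V = 2 * l + 1 \<longrightarrow> G \<subseteq> Pow V
    \<longrightarrow> card G \<le> 3 * 2 ^ l
    \<longrightarrow> (\<exists>A\<subseteq>G. card {(x, y) \<in> G \<times> G. x \<inter> y = {} \<and> (x \<in> A \<longleftrightarrow> y \<in> A)} \<le> \<epsilon> * 2 ^ (2 * l))"
proof -
  \<comment> \<open>In units of \<open>2 ^ (2 * l)\<close>, each of the four error terms of
    \<open>colouring_from_cover\<close> gets \<open>\<epsilon> / 4\<close>. Uncovered pairs cost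
    \<open>6 * \<kappa> = \<epsilon> / 8\<close> and enter twice; 504 below is 4 * 126.\<close>
  define \<kappa> where "\<kappa> = \<epsilon> / 48"
  have \<kappa>: "0 < \<kappa>" using \<epsilon> by (simp add: \<kappa>_def)
  obtain m0 :: nat where m0: "504 / \<epsilon> < m0" using reals_Archimedean2 by blast
  define m where "m = Suc m0"
  have m: "0 < m" "504 \<le> \<epsilon> * m" using m0 \<epsilon> by (auto simp: m_def field_simps)
  define s where "s = 3 * m"
  define \<eta> where "\<eta> = \<kappa> * (\<kappa> / 3) ^ s / 2"
  have \<eta>: "0 < \<eta>" using \<kappa> by (simp add: \<eta>_def)
  \<comment> \<open>\<open>r\<close> bounds the number of covering sets independently of
    \<open>l\<close>. As \<open>m\<close> is fixed before \<open>l\<close>, the later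
    \<open>d = l div m\<close> is a small fraction of \<open>l\<close> that still tends to infinity,
    so \<open>q ^ d\<close> and \<open>(1/2) ^ d\<close> beat the fixed powers of
    \<open>r\<close>.\<close>
  define r where "r = 3 / \<eta>"
  have r: "0 < r" using \<eta> by (simp add: r_def)
  define q :: real where "q = 4 * (3/4) ^ 6"
  have q: "0 \<le> q" "q < 1" by (simp_all add: q_def power_numeral_reduce)
  have "(\<lambda>n. r\<^sup>2 * q ^ n) \<longlonglongrightarrow> r\<^sup>2 * 0" using q by (intro tendsto_intros LIMSEQ_power_zero) auto
  moreover have "(\<lambda>n. 6 * r * (1/2) ^ n) \<longlonglongrightarrow> 6 * r * 0"
    by (intro tendsto_intros LIMSEQ_power_zero) auto
  ultimately have "\<forall>\<^sub>F n in sequentially. r\<^sup>2 * q ^ n < \<epsilon> / 4 \<and> 6 * r * (1/2) ^ n < \<epsilon> / 4"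
    using \<epsilon> by (intro eventually_conj order_tendstoD(2)) auto
  then obtain d0 where d0: "\<And>n. d0 \<le> n \<Longrightarrow> r\<^sup>2 * q ^ n < \<epsilon> / 4 \<and> 6 * r * (1/2) ^ n < \<epsilon> / 4"
    by (auto simp: eventually_sequentially)
  obtain l1 where l1: "12 * 8 ^ m / \<kappa> ^ (s + 1) < 2 ^ l1" using real_arch_pow[of 2] by auto
  show ?thesis
  proof (intro exI[of _ "max l1 (m * d0)"] allI impI)
    fix l :: nat and G :: "'a set set" and V :: "'a set"
    assume l: "max l1 (m * d0) \<le> l" and V: "finite V" "card V = 2 * l + 1"
      and G: "G \<subseteq> Pow V" "card G \<le> 3 * 2 ^ l"
    define d where "d = l div m"
    have dl: "d \<le> l" by (simp add: d_def)
    have "m * d0 div m \<le> l div m" using l by (intro div_le_mono) simp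
    hence d_ge: "d0 \<le> d" using m by (simp add: d_def)
    have "12 * 8 ^ m / \<kappa> ^ (s + 1) < 2 ^ l"
      by (rule less_le_trans[OF l1]) (use l in \<open>simp add: power_increasing\<close>)
    hence "12 * 8 ^ m < \<kappa> ^ (3 * m + 1) * 2 ^ l"
      using \<kappa> by (simp add: s_def pos_divide_less_eq mult.commute)
    hence large: "3 * 2 ^ l * (2 ^ (2 * l + 1) * (2 ^ (l - d)) ^ s) < \<kappa> * 2 ^ l * (\<kappa> * 2 ^ l) ^ s / 2"
      unfolding d_def s_def by (rule tuple_count_bound[OF \<kappa> m(1)])
    have finG: "finite G" using G V by (auto intro: finite_subset)
    have cG: "real (card G) \<le> 3 * 2 ^ l"
    proof -
      have "real (card G) \<le> real (3 * 2 ^ l)" using G(2) by (simp only: of_nat_le_iff)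
      thus ?thesis by simp
    qed
    define R0 where "R0 = {x \<in> G. \<kappa> * 2 ^ l \<le> card {y \<in> G. x \<inter> y = {}}}"
    have R0: "R0 \<subseteq> G" "finite R0" using finG by (auto simp: R0_def)
    have "\<exists>\<W>. finite \<W> \<and> (\<forall>W\<in>\<W>. W \<subseteq> V \<and> card W \<le> l + d) \<and> card \<W> * (\<eta> * 2 ^ l) \<le> card R0
        \<and> card {x \<in> R0. \<forall>W\<in>\<W>. \<not> x \<subseteq> W} < \<kappa> * 2 ^ l"
    proof (rule few_sets_cover[OF _ _ _ R0(2) order_refl])
      fix R assume R: "R \<subseteq> R0" "\<kappa> * 2 ^ l \<le> card R"
      have "\<exists>W\<subseteq>V. card W \<le> l + d \<and> \<kappa> * (\<kappa> / 3) ^ s / 2 * 2 ^ l \<le> card (R \<inter> Pow W)"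
        by (rule rich_set[OF V G _ \<kappa> _ R(2) large]) (use R R0 in \<open>auto simp: R0_def\<close>)
      thus "\<exists>W. (W \<subseteq> V \<and> card W \<le> l + d) \<and> \<eta> * 2 ^ l \<le> card (R \<inter> Pow W)"
        by (auto simp: \<eta>_def)
    qed (use \<eta> \<kappa> in auto)
    then obtain \<W> where \<W>: "finite \<W>" "\<And>W. W \<in> \<W> \<Longrightarrow> W \<subseteq> V \<and> card W \<le> l + d"
      "card \<W> * (\<eta> * 2 ^ l) \<le> card R0" "card {x \<in> R0. \<forall>W\<in>\<W>. \<not> x \<subseteq> W} < \<kappa> * 2 ^ l"
      by auto
    have "card \<W> * (\<eta> * 2 ^ l) \<le> 3 * 2 ^ l"
      using \<W>(3) cG card_mono[OF finG R0(1)] by linarith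
    hence cW: "card \<W> \<le> r" using \<eta> by (simp add: r_def pos_le_divide_eq)
    have sq: "(2::real) ^ (2 * l) = 2 ^ l * 2 ^ l" by (simp add: mult_2 power_add)
    \<comment> \<open>An uncovered \<open>x\<close> either has few disjoint partners or is one of
      the fewer than \<open>\<kappa> * 2 ^ l\<close> members of \<open>R0\<close> left by the cover.
      Each case yields at most \<open>3 * \<kappa> * 2 ^ (2 * l)\<close> pairs.\<close>
    have unc: "card {(x, y) \<in> G \<times> G. x \<inter> y = {} \<and> (\<forall>W\<in>\<W>. \<not> x \<subseteq> W)} \<le> \<epsilon> / 8 * 2 ^ (2 * l)"
    proof -
      let ?B = "{x \<in> R0. \<forall>W\<in>\<W>. \<not> x \<subseteq> W}"
      let ?L = "{(x, y) \<in> (G - R0) \<times> G. x \<inter> y = {}}"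
      have "{(x, y) \<in> G \<times> G. x \<inter> y = {} \<and> (\<forall>W\<in>\<W>. \<not> x \<subseteq> W)} \<subseteq> ?L \<union> ?B \<times> G"
        using R0 by auto
      moreover have "finite (?L \<union> ?B \<times> G)"
        by (rule finite_subset[of _ "G \<times> G"]) (use finG R0 in auto)
      ultimately have "card {(x, y) \<in> G \<times> G. x \<inter> y = {} \<and> (\<forall>W\<in>\<W>. \<not> x \<subseteq> W)} \<le> card (?L \<union> ?B \<times> G)"
        by (intro card_mono)
      also have "\<dots> \<le> card ?L + card (?B \<times> G)" by (rule card_Un_le)
      finally have "real (card {(x, y) \<in> G \<times> G. x \<inter> y = {} \<and> (\<forall>W\<in>\<W>. \<not> x \<subseteq> W)})
          \<le> real (card ?L + card (?B \<times> G))" by (simp only: of_nat_le_iff)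
      also have "\<dots> = real (card ?L) + real (card ?B) * real (card G)"
        by (simp add: card_cartesian_product)
      also have "real (card ?L) \<le> real (card (G - R0)) * (\<kappa> * 2 ^ l)"
        by (rule card_pairs_upper) (use finG in \<open>auto simp: R0_def\<close>)
      also have "\<dots> \<le> (3 * 2 ^ l) * (\<kappa> * 2 ^ l)"
      proof (rule mult_right_mono)
        have "card (G - R0) \<le> card G" using finG by (intro card_mono) auto
        thus "real (card (G - R0)) \<le> 3 * 2 ^ l" using cG by linarith
      qed (use \<kappa> in simp)
      also have "real (card ?B) * real (card G) \<le> (\<kappa> * 2 ^ l) * (3 * 2 ^ l)"
        using \<W>(4) cG by (intro mult_mono) auto
      finally show ?thesis unfolding sq by (simp add: \<kappa>_def algebra_simps)
    qed
    have c: "126 * real d * 2 ^ (2 * l) < real (2 * l + 1) * (\<epsilon> / 4 * 2 ^ (2 * l))"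
    proof -
      have "504 * real d \<le> \<epsilon> * m * d" using m by (intro mult_right_mono) auto
      also have "\<dots> = \<epsilon> * real (m * d)" by simp
      also have "m * d \<le> l" by (simp add: d_def)
      also have "\<epsilon> * real l < \<epsilon> * (2 * l + 1)" using \<epsilon> by simp
      finally have "504 * real d < (2 * l + 1) * \<epsilon>" using \<epsilon> by (simp add: mult.commute)
      thus ?thesis by simp
    qed
    from colouring_from_cover[OF V G \<W>(1,2) unc c] obtain A where A: "A \<subseteq> G"
      "card {(x, y) \<in> G \<times> G. x \<inter> y = {} \<and> (x \<in> A \<longleftrightarrow> y \<in> A)}
        \<le> 2 * (\<epsilon> / 8 * 2 ^ (2 * l)) + 2 * (real (card \<W>) * 2 ^ (l - d) * (3 * 2 ^ l))
       + real (card \<W>) ^ 2 * (2 ^ (2 * l) * q ^ d) + \<epsilon> / 4 * 2 ^ (2 * l)"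
      unfolding q_def by blast
    have "2 * (real (card \<W>) * 2 ^ (l - d) * (3 * 2 ^ l)) \<le> 2 * (r * 2 ^ (l - d) * (3 * 2 ^ l))"
      using cW by (intro mult_left_mono mult_right_mono) auto
    also have "\<dots> = 6 * r * (1/2) ^ d * 2 ^ (2 * l)"
    proof -
      have "(2::real) ^ (l - d) = (1/2) ^ d * 2 ^ l"
        using dl by (simp add: power_diff power_divide)
      thus ?thesis by (simp add: sq)
    qed
    also have "\<dots> \<le> \<epsilon> / 4 * 2 ^ (2 * l)" using d0[OF d_ge] by (intro mult_right_mono) auto
    finally have 1: "2 * (real (card \<W>) * 2 ^ (l - d) * (3 * 2 ^ l)) \<le> \<epsilon> / 4 * 2 ^ (2 * l)" .
    have "real (card \<W>) ^ 2 * (2 ^ (2 * l) * q ^ d) \<le> r ^ 2 * (2 ^ (2 * l) * q ^ d)"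
      using cW q by (intro mult_right_mono power_mono) auto
    also have "\<dots> = r ^ 2 * q ^ d * 2 ^ (2 * l)" by simp
    also have "\<dots> \<le> \<epsilon> / 4 * 2 ^ (2 * l)" using d0[OF d_ge] by (intro mult_right_mono) auto
    finally have 2: "real (card \<W>) ^ 2 * (2 ^ (2 * l) * q ^ d) \<le> \<epsilon> / 4 * 2 ^ (2 * l)" .
    have "card {(x, y) \<in> G \<times> G. x \<inter> y = {} \<and> (x \<in> A \<longleftrightarrow> y \<in> A)} \<le> \<epsilon> * 2 ^ (2 * l)"
    proof -
      have "\<epsilon> * 2 ^ (2 * l) = 2 * (\<epsilon> / 8 * 2 ^ (2 * l)) + \<epsilon> / 4 * 2 ^ (2 * l) + \<epsilon> / 4 * 2 ^ (2 * l)
          + \<epsilon> / 4 * 2 ^ (2 * l)" by simp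
      thus ?thesis using A(2) 1 2 by linarith
    qed
    thus "\<exists>A\<subseteq>G. card {(x, y) \<in> G \<times> G. x \<inter> y = {} \<and> (x \<in> A \<longleftrightarrow> y \<in> A)} \<le> \<epsilon> * 2 ^ (2 * l)"
      using A(1) by blast
  qed
qed

section \<open>Stability of nearly generating pairs\<close>

lemma factor_lower:
  fixes x y d :: real
  assumes "x + y \<le> 3" "2 - d \<le> x * y" "0 \<le> x" "0 \<le> d"
  shows "1 - d \<le> x"
proof (rule ccontr)
  assume n: "\<not> ?thesis"
  have "x * y \<le> x * (3 - x)" using assms by (intro mult_left_mono) auto
  \<comment> \<open>\<open>2 - x * (3 - x)\<close> factors as \<open>(1 - x) * (2 - x)\<close>, and
    it is at most \<open>d\<close>.\<close>
  moreover have "(1 - x) * (2 - x) \<ge> (1 - x) * 1" using n assms by (intro mult_left_mono) auto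
  ultimately show False using n assms(2) by (simp add: algebra_simps)
qed

text \<open>Adding \<open>missing\<close> to \<open>waste\<close> eliminates \<open>z\<close> and leaves an inequality whose coefficient of
  \<open>f\<close> is nonnegative up to \<open>O(d)\<close>, with equality at \<open>a = 3/2\<close>, \<open>e = 1/2\<close>; hence \<open>f\<close> can be
  dropped first and is only bounded at the end.\<close>

lemma stability_inequalities:
  fixes a b e f t m z d u :: real
  assumes d: "0 \<le> d" "d \<le> 1/100000" and u: "u = 1/3 - d"
    and nonneg: "0 \<le> e" "0 \<le> f" "0 \<le> t" "0 \<le> m"
    and a: "a = 1 - t + e" and b: "b = 2 - m + f"
    and sum: "a + b \<le> 3" and prod: "2 - d \<le> a * b" 
    and ab0: "0 \<le> a" "0 \<le> b"
    and e_bound: "e \<le> a/3 + 10 * d" and f_bound: "f \<le> b/3 + 10 * d"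
    and missing: "m * (1 - e) \<le> f/2 + z + d"
    and waste: "e * u * b + f * u * a - e * f + z \<le> a * b - 2 + d"
  shows "e + t + f + m \<le> 20000 * d"
proof -
  \<comment> \<open>The extremal sizes are 1 and 2; \<open>g\<close> is the surplus of
    \<open>a\<close> and \<open>h\<close> the deficit of \<open>b\<close>, so the bound on
    \<open>a + b\<close> reads \<open>g \<le> h\<close>.\<close>
  define g h where "g = a - 1" and "h = 2 - b"
  have gh: "g \<le> h" using sum by (simp add: g_def h_def)
  have m_eq: "m = f + h" and e_eq: "e = g + t" and ag: "a = 1 + g" and bh: "b = 2 - h"
    using a b by (simp_all add: g_def h_def)
  have a_low: "1 - d \<le> a" using factor_lower[of a b d] sum prod ab0 d by simp
  have b_low: "1 - d \<le> b"
    using factor_lower[of b a d] sum prod ab0 d by (simp add: add.commute mult.commute)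
  have g_low: "- d \<le> g" using a_low by (simp add: g_def)
  have h_up: "h \<le> 1 + d" using b_low by (simp add: h_def)
  have a_up: "a \<le> 3/2 + 15 * d" using e_bound a nonneg by linarith
  have e_up: "e \<le> 1/2 + 15 * d" using e_bound a_up by linarith
  have f_up: "f \<le> 1" using f_bound sum a_low d by linarith
  have main: "e * u * b + h * (1 - e) + f * (u * a - 2 * e + 1/2) \<le> 2 * g - h - g * h + 2 * d"
    using missing waste unfolding m_eq ag bh by (simp add: algebra_simps)
  have ad: "a * d \<le> 3 * d" using a_up d by (intro mult_right_mono) auto
  have coef: "u * a - 2 * e + 1/2 \<ge> - 28 * d"
    using e_bound a_up ad unfolding u by (simp add: algebra_simps)
  have "f * (u * a - 2 * e + 1/2) \<ge> - 28 * d"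
  proof -
    have "f * (u * a - 2 * e + 1/2) \<ge> f * (- 28 * d)"
      using coef nonneg by (intro mult_left_mono) auto
    moreover have "f * (28 * d) \<le> 1 * (28 * d)" using f_up d by (intro mult_right_mono) auto
    ultimately show ?thesis by simp
  qed
  with main have main2: "e * u * b + h * (2 - e) \<le> 2 * g - g * h + 30 * d"
    by (simp add: algebra_simps)
  have u_low: "u \<ge> 1/4" "u \<le> 1/3" using u d by auto
  have ub: "0 \<le> u * b" using u_low ab0 by simp
  have "g * (u * b) \<le> e * (u * b)" using ub e_eq nonneg by (intro mult_right_mono) auto
  moreover have "g * (2 - e) \<le> h * (2 - e)" using gh e_up d by (intro mult_right_mono) auto
  \<comment> \<open>Replacing \<open>e * (u * b)\<close> by \<open>g * (u * b)\<close> and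
    \<open>h * (2 - e)\<close> by \<open>g * (2 - e)\<close> cancels \<open>2 * g\<close>. The
    remaining factor of \<open>g\<close> is bounded away from 0, which forces \<open>g\<close> to be
    \<open>O(d)\<close>.\<close>
  ultimately have gg: "g * (u * b + h - e) \<le> 30 * d"
    using main2 by (simp add: algebra_simps)
  have "h * (1 - u) \<ge> (- d) * 1"
  proof -
    have "h * (1 - u) \<ge> (- d) * (1 - u)" using gh g_low u_low by (intro mult_right_mono) auto
    moreover have "d * (1 - u) \<le> d * 1" using d u_low by (intro mult_left_mono) auto
    ultimately show ?thesis by linarith
  qed
  moreover have "u * b + h - e = 2 * u + h * (1 - u) - e" unfolding bh by (simp add: algebra_simps)
  ultimately have pos: "u * b + h - e \<ge> 1/12" using e_up d u by linarith
  have g_up: "g \<le> 360 * d"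
  proof (cases "g \<le> 0")
    case False
    hence "g * (1/12) \<le> g * (u * b + h - e)" using pos by (intro mult_left_mono) auto
    thus ?thesis using gg by simp
  qed (use d in auto)
  have gh_up: "- (g * h) \<le> 2 * d"
  proof (cases "h \<ge> 0")
    case True
    have "(- g) * h \<le> d * h" using g_low True by (intro mult_right_mono) auto
    also have "\<dots> \<le> d * 2" using h_up d by (intro mult_left_mono) auto
    finally show ?thesis by simp
  next
    case False
    hence "g \<le> 0" using gh by simp
    hence "g * h \<ge> 0" using False by (intro mult_nonpos_nonpos) auto
    thus ?thesis using d by simp
  qed
  have rhs: "e * u * b + h * (2 - e) \<le> 752 * d" using main2 g_up gh_up by simp
  have h_low: "h \<ge> - d" using gh g_low by simp
  have "h * (2 - e) \<ge> - d * (2 - e)" using h_low e_up d by (intro mult_right_mono) auto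
  moreover have "d * (2 - e) \<le> d * 2" using d nonneg by (intro mult_left_mono) auto
  ultimately have hl: "h * (2 - e) \<ge> - 2 * d" by linarith
  have ub_low: "u * b \<ge> 1/4 * (9/10)" using u_low b_low d by (intro mult_mono) auto
  have "e * (1/4 * (9/10)) \<le> e * (u * b)" using ub_low nonneg by (intro mult_left_mono) auto
  moreover have "e * (u * b) \<le> 754 * d" using rhs hl by (simp add: mult.assoc)
  ultimately have e_small: "e \<le> 3400 * d" using d by linarith
  have h_small: "h \<le> 752 * d"
  proof (cases "h \<le> 0")
    case False
    have "h * 1 \<le> h * (2 - e)" using False e_up d by (intro mult_left_mono) auto
    moreover have "e * u * b \<ge> 0" using nonneg ub by (simp add: mult.assoc)
    ultimately show ?thesis using rhs by simp
  qed (use d in auto)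
  \<comment> \<open>Second pass: with \<open>e\<close> now known to be small, the coefficient of
    \<open>f\<close> in \<open>main\<close> is bounded below, so the term dropped before can be
    recovered.\<close>
  have "u * a \<ge> 0" using u_low ab0 by simp
  hence coef2: "u * a - 2 * e + 1/2 \<ge> 1/4" using e_small d by simp
  have "f * (1/4) \<le> f * (u * a - 2 * e + 1/2)" using coef2 nonneg by (intro mult_left_mono) auto
  moreover have "h * (1 - e) \<ge> - d"
  proof -
    have "h * (1 - e) \<ge> - d * (1 - e)" using h_low e_up d by (intro mult_right_mono) auto
    moreover have "d * (1 - e) \<le> d * 1" using d nonneg by (intro mult_left_mono) auto
    ultimately show ?thesis by linarith
  qed
  moreover have "e * u * b \<ge> 0" using nonneg ub by (simp add: mult.assoc)
  ultimately have "f * (1/4) \<le> 726 * d" using main g_up gh_up h_low by linarith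
  hence f_small: "f \<le> 2904 * d" by simp
  show ?thesis using e_small f_small h_small g_low e_eq m_eq d by linarith
qed

text \<open>The value \<open>1/3\<close> is the root of \<open>2 y (1 - y) = 4/9\<close> below \<open>1/2\<close>; the constant \<open>4/9\<close> comes from
  \<open>ab \<le> 9/4\<close> when \<open>a + b \<le> 3\<close>.\<close>

lemma third_of_balance:
  fixes x y d :: real
  assumes "0 \<le> x" "x \<le> y" "0 \<le> d" "x + y - 2 * x * y \<ge> 4/9 * (1 - d)"
  shows "1/3 - d \<le> y"
proof (rule ccontr)
  assume n: "\<not> ?thesis"
  have y: "y < 1/3" using n assms by simp
  have "x * (1 - 2 * y) \<le> y * (1 - 2 * y)" using assms y by (intro mult_right_mono) auto
  hence "x + y - 2 * x * y \<le> 2 * (y - y * y)" by (simp add: algebra_simps)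
  hence "4/9 * (1 - d) \<le> 2 * (y - y * y)" using assms(4) by (rule order_trans[rotated])
  moreover have "(1/3 - y) * (2/3 - y) = 2/9 - (y - y * y)" by (simp add: field_simps)
  ultimately have "(1/3 - y) * (2/3 - y) \<le> 2/9 * d" by argo
  moreover have "(1/3 - y) * (1/3) \<le> (1/3 - y) * (2/3 - y)" using y by (intro mult_left_mono) auto
  ultimately have "(1/3 - y) * (1/3) \<le> 2/9 * d" by (rule order_trans[rotated])
  hence "1 \<le> 2 * d + 3 * y" by (simp add: field_simps)
  moreover have "3 * d + 3 * y < 1" using n by (simp add: field_simps)
  ultimately show False using assms(3) by linarith
qed

text \<open>From \<open>a + b \<le> 3\<close> follows \<open>a * b \<le> 9/4\<close>, hence
  \<open>a * b - 2 \<le> a * b / 9\<close>. Inserting this in the last hypothesis and dividing by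
  \<open>b\<close> gives \<open>e \<le> a/3\<close> up to \<open>O(d)\<close>.\<close>

lemma extras_inequality:
  fixes a b e d :: real
  assumes d: "0 \<le> d" "d \<le> 1/100000" and sum: "a + b \<le> 3" and prod: "2 - d \<le> a * b"
    and "0 \<le> a" "0 \<le> b" "0 \<le> e" "e \<le> a" and e: "e * (1/3 - d) * b \<le> a * b - (2 - d)"
  shows "e \<le> a/3 + 10 * d" "1 - d \<le> a" "1 - d \<le> b"
proof -
  show a: "1 - d \<le> a" using factor_lower[of a b d] assms by simp
  show b: "1 - d \<le> b"
    using factor_lower[of b a d] assms by (simp add: add.commute mult.commute)
  have "(a + b) * (a + b) \<le> 3 * 3" using assms by (intro mult_mono) auto
  moreover have "0 \<le> (a - b) * (a - b)" by simp
  ultimately have "4 * (a * b) \<le> 9" by (simp add: algebra_simps)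
  moreover define q where "q = e * (1/3 - d) - a/9"
  moreover have "b * q = e * (1/3 - d) * b - a * b / 9" by (simp add: q_def algebra_simps)
  moreover have "18 \<le> e * (1/3 - d) * b * (-9) + 9 * (a * b) + 9 * d" using e by linarith
  ultimately have "b * q \<le> d" by linarith
  moreover have "(9/10) * q \<le> b * q" if "0 \<le> q"
    using that b d by (intro mult_right_mono) auto
  ultimately have "(9/10) * q \<le> d" using d by (cases "0 \<le> q") auto
  moreover have "e * d \<le> (201/100) * d" using assms b by (intro mult_right_mono) auto
  moreover have "q = e / 3 - e * d - a/9" by (simp add: q_def algebra_simps)
  ultimately show "e \<le> a/3 + 10 * d" using d by linarith
qed

section \<open>Point frequencies and the partition they induce\<close>

locale near_generating_pair =
  fixes V :: "'a set" and A B :: "'a set set" and l :: nat and d :: real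
  assumes finite_V: "finite V" and card_V: "card V = 2 * l + 1"
    and A_sub: "A \<subseteq> Pow V" and B_sub: "B \<subseteq> Pow V"
    and card_sum: "card A + card B \<le> 3 * 2 ^ l"
    and missing: "card (Pow V - disjoint_unions A B) \<le> d * 2 ^ (2 * l)"
    and d_nonneg: "0 \<le> d" and d_small: "d \<le> 1/100000"
begin

lemma finite_AB: "finite A" "finite B"
  using finite_V A_sub B_sub by (auto intro: finite_subset)

text \<open>The hypotheses are symmetric in the two families; interpreting this instance transfers
  every statement about one family to the other.\<close>

lemma swap: "near_generating_pair V B A l d"
  using finite_V card_V A_sub B_sub card_sum missing d_nonneg d_small
  by unfold_locales (simp_all add: disjoint_unions_commute add.commute)

lemma card_sum_real: "real (card A) + real (card B) \<le> 3 * 2 ^ l"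
proof -
  have "real (card A + card B) \<le> real (3 * 2 ^ l)" using card_sum by (simp only: of_nat_le_iff)
  thus ?thesis by simp
qed

lemma card_prod_upper: "4 * (real (card A) * real (card B)) \<le> 9 * 2 ^ (2 * l)"
proof -
  let ?a = "real (card A)" and ?b = "real (card B)"
  have "(?a + ?b) * (?a + ?b) \<le> (3 * 2 ^ l) * (3 * 2 ^ l)"
    using card_sum_real by (intro mult_mono) auto
  moreover have "0 \<le> (?a - ?b) * (?a - ?b)" by simp
  moreover have "(2::real) ^ (2 * l) = 2 ^ l * 2 ^ l" by (simp add: mult_2 power_add)
  ultimately show ?thesis by (simp add: algebra_simps)
qed

text \<open>With relative frequencies \<open>x \<le> y\<close> of \<open>i\<close> in
  \<open>A\<close> and \<open>B\<close>, the unions containing \<open>i\<close> come from a fraction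
  \<open>x + y - 2 * x * y\<close> of all pairs. As \<open>card A * card B\<close> is at most 9/4 of
  \<open>2 ^ (2 * l)\<close>, \<open>third_of_balance\<close> applies. The cross-multiplied
  hypothesis makes sense for empty families too.\<close>

lemma marginal_lower:
  assumes i: "i \<in> V"
    and le: "card {x \<in> A. i \<in> x} * card B \<le> card {y \<in> B. i \<in> y} * card A"
  shows "(1/3 - d) * card B \<le> card {y \<in> B. i \<in> y}"
proof -
  define a1 a0 b1 b0 where "a1 = real (card {x \<in> A. i \<in> x})" and "a0 = real (card {x \<in> A. i \<notin> x})"
    and "b1 = real (card {y \<in> B. i \<in> y})" and "b0 = real (card {y \<in> B. i \<notin> y})"
  define a b where "a = real (card A)" and "b = real (card B)"
  have ab: "a = a1 + a0" "b = b1 + b0"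
    using card_filter_split[OF finite_AB(1), of "\<lambda>x. i \<in> x"]
      card_filter_split[OF finite_AB(2), of "\<lambda>x. i \<in> x"]
    by (simp_all add: a_def b_def a0_def b0_def a1_def b1_def flip: of_nat_add)
  have nonneg: "0 \<le> a1" "0 \<le> a0" "0 \<le> b1" "0 \<le> b0"
    by (simp_all add: a0_def b0_def a1_def b1_def)
  have k: "card V = Suc (2 * l)" using card_V by simp
  have "real (2 ^ (2 * l)) \<le> real (card (Pow V - disjoint_unions A B)
      + (card {x \<in> A. i \<in> x} * card {y \<in> B. i \<notin> y} + card {x \<in> A. i \<notin> x} * card {y \<in> B. i \<in> y}))"
    using coordinate_bounds(2)[OF finite_V k A_sub B_sub i] by (simp only: of_nat_le_iff)
  hence "2 ^ (2 * l) \<le> d * 2 ^ (2 * l) + (a1 * b0 + a0 * b1)"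
    using missing by (simp add: a0_def b0_def a1_def b1_def)
  hence mixed: "(1 - d) * 2 ^ (2 * l) \<le> a1 * b0 + a0 * b1" by (simp add: algebra_simps)
  moreover have "0 < (1 - d) * 2 ^ (2 * l)" using d_small by simp
  ultimately have pos: "0 < a" "0 < b" using ab nonneg
    by (smt (verit) mult_eq_0_iff)+
  define x y where "x = a1 / a" and "y = b1 / b"
  have "real (card {x \<in> A. i \<in> x} * card B) \<le> real (card {y \<in> B. i \<in> y} * card A)"
    using le by (simp only: of_nat_le_iff)
  hence "x \<le> y" using pos by (simp add: x_def y_def field_simps a1_def b1_def a_def b_def)
  moreover have "0 \<le> x" using nonneg pos by (simp add: x_def)
  moreover have "x + y - 2 * x * y = (a1 * b0 + a0 * b1) / (a * b)"
  proof -
    have "x + y - 2 * x * y = (a1 * b + b1 * a - 2 * a1 * b1) / (a * b)"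
      using pos by (simp add: x_def y_def field_simps)
    also have "a1 * b + b1 * a - 2 * a1 * b1 = a1 * b0 + a0 * b1"
      unfolding ab by (simp add: algebra_simps)
    finally show ?thesis .
  qed
  moreover have "4/9 * (1 - d) \<le> (a1 * b0 + a0 * b1) / (a * b)"
  proof -
    have "4/9 * (1 - d) * (a * b) \<le> (1 - d) * 2 ^ (2 * l)"
    proof -
      have "(1 - d) * (4 * (a * b)) \<le> (1 - d) * (9 * 2 ^ (2 * l))"
        using card_prod_upper d_small by (intro mult_left_mono) (auto simp: a_def b_def)
      moreover have "4/9 * (1 - d) * (a * b) = (1 - d) * (4 * (a * b)) / 9"
        "(1 - d) * 2 ^ (2 * l) = (1 - d) * (9 * 2 ^ (2 * l)) / 9" by simp_all
      ultimately show ?thesis by (simp only: divide_right_mono)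
    qed
    thus ?thesis using mixed pos by (simp add: pos_le_divide_eq)
  qed
  ultimately have "1/3 - d \<le> y" using third_of_balance d_nonneg by metis
  hence "(1/3 - d) * b \<le> y * b" using pos by (intro mult_right_mono) auto
  thus ?thesis using pos by (simp add: y_def b_def b1_def)
qed

lemma card_disjoint_unions_lower: "(2 - d) * 2 ^ (2 * l) \<le> card (disjoint_unions A B)"
proof -
  have sub: "disjoint_unions A B \<subseteq> Pow V" by (rule disjoint_unions_subset[OF A_sub B_sub])
  have "card (Pow V) = card (Pow V - disjoint_unions A B) + card (disjoint_unions A B)"
    using card_Diff_subset[OF finite_subset[OF sub] sub] card_mono[OF _ sub] finite_V by simp
  hence "real (2 ^ (2 * l + 1)) = real (card (Pow V - disjoint_unions A B) + card (disjoint_unions A B))"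
    by (simp only: card_Pow[OF finite_V] card_V)
  thus ?thesis using missing by (simp add: algebra_simps)
qed

lemma nondisjoint_upper:
  "card {(x, y) \<in> A \<times> B. x \<inter> y \<noteq> {}} \<le> real (card A) * real (card B) - (2 - d) * 2 ^ (2 * l)"
proof -
  have "real (card (disjoint_unions A B) + card {(x, y) \<in> A \<times> B. x \<inter> y \<noteq> {}})
      \<le> real (card A * card B)"
    using card_disjoint_unions_le[OF finite_AB] by (simp only: of_nat_le_iff)
  thus ?thesis using card_disjoint_unions_lower by simp
qed

text \<open>A member of \<open>A\<close> outside \<open>Pow P\<close> contains a point of
  \<open>Q\<close>, hence meets every member of \<open>B\<close> through that point.\<close>

lemma extras_waste:
  assumes Q: "\<And>i. i \<in> Q \<Longrightarrow> (1/3 - d) * card B \<le> card {y \<in> B. i \<in> y}" and V: "V \<subseteq> P \<union> Q"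
  shows "card (A - Pow P) * ((1/3 - d) * card B) \<le> card {(x, y) \<in> (A - Pow P) \<times> B. x \<inter> y \<noteq> {}}"
proof (rule card_pairs_lower)
  fix x assume "x \<in> A - Pow P"
  hence "x \<inter> Q \<noteq> {}" using A_sub V by auto
  thus "(1/3 - d) * card B \<le> card {y \<in> B. x \<inter> y \<noteq> {}}"
    using Q finite_AB by (intro card_meeting_lower) auto
qed (use finite_AB in auto)

text \<open>The pairs wasted by the extra members must fit into the surplus allowed by
  \<open>nondisjoint_upper\<close>; after scaling by \<open>2 ^ l\<close> this is the setting of
  \<open>extras_inequality\<close>.\<close>

lemma extras_upper:
  assumes Q: "\<And>i. i \<in> Q \<Longrightarrow> (1/3 - d) * card B \<le> card {y \<in> B. i \<in> y}" and V: "V \<subseteq> P \<union> Q"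
  defines "a \<equiv> real (card A) / 2 ^ l" and "b \<equiv> real (card B) / 2 ^ l"
    and "e \<equiv> real (card (A - Pow P)) / 2 ^ l"
  shows "e \<le> a/3 + 10 * d" "1 - d \<le> a" "1 - d \<le> b" "a + b \<le> 3" "2 - d \<le> a * b"
proof -
  have N: "(2::real) ^ (2 * l) = 2 ^ l * 2 ^ l" by (simp add: mult_2 power_add)
  have "card {(x, y) \<in> (A - Pow P) \<times> B. x \<inter> y \<noteq> {}} \<le> card {(x, y) \<in> A \<times> B. x \<inter> y \<noteq> {}}"
    by (rule card_mono, rule finite_subset[of _ "A \<times> B"]) (use finite_AB in auto)
  hence w: "card (A - Pow P) * ((1/3 - d) * card B) \<le> real (card A) * real (card B) - (2 - d) * 2 ^ (2 * l)"
    using extras_waste[OF Q V] nondisjoint_upper by linarith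
  show sum: "a + b \<le> 3" using card_sum_real by (simp add: a_def b_def field_simps)
  have "0 \<le> card (A - Pow P) * ((1/3 - d) * card B)" using d_small by simp
  hence "(2 - d) * (2 ^ l * 2 ^ l) \<le> real (card A) * real (card B)" using w N by simp
  thus prod: "2 - d \<le> a * b" by (simp add: a_def b_def field_simps)
  have e: "e * (1/3 - d) * b \<le> a * b - (2 - d)"
  proof -
    have "card (A - Pow P) * ((1/3 - d) * card B) / (2 ^ l * 2 ^ l)
        \<le> (real (card A) * real (card B) - (2 - d) * (2 ^ l * 2 ^ l)) / (2 ^ l * 2 ^ l)"
      using w unfolding N by (intro divide_right_mono) auto
    thus ?thesis by (simp add: a_def b_def e_def diff_divide_distrib mult_ac)
  qed
  have "card (A - Pow P) \<le> card A" using finite_AB by (intro card_mono) auto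
  hence "e \<le> a" by (simp add: e_def a_def divide_right_mono)
  moreover have "0 \<le> a" "0 \<le> b" "0 \<le> e" by (simp_all add: a_def b_def e_def)
  ultimately show "e \<le> a/3 + 10 * d" "1 - d \<le> a" "1 - d \<le> b"
    using extras_inequality[OF d_nonneg d_small sum prod _ _ _ _ e] by auto
qed

text \<open>If \<open>P\<close> had fewer than \<open>l\<close> points, \<open>Pow P\<close> would
  hold at most half a unit of \<open>2 ^ l\<close>. Since about two thirds of \<open>A\<close> lie
  in \<open>Pow P\<close>, this would leave \<open>A\<close> with about 3/4 of a unit, against the
  lower bound \<open>1 - d\<close>.\<close>

lemma card_part_lower:
  assumes Q: "\<And>i. i \<in> Q \<Longrightarrow> (1/3 - d) * card B \<le> card {y \<in> B. i \<in> y}" and V: "V \<subseteq> P \<union> Q"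
    and P: "finite P"
  shows "l \<le> card P"
proof (rule ccontr)
  assume "\<not> ?thesis"
  hence "(2::real) ^ (Suc (card P)) \<le> 2 ^ l" by (intro power_increasing) auto
  moreover have "card (A \<inter> Pow P) \<le> card (Pow P)" using P by (intro card_mono) auto
  hence "card (A \<inter> Pow P) \<le> 2 ^ card P" by (simp add: card_Pow[OF P])
  hence "real (card (A \<inter> Pow P)) \<le> 2 ^ card P"
    by (metis of_nat_le_iff of_nat_numeral of_nat_power)
  ultimately have "2 * real (card (A \<inter> Pow P)) \<le> 2 ^ l"
    by (simp only: power_Suc)
  hence "real (card (A \<inter> Pow P)) / 2 ^ l \<le> 1 / 2" by (simp add: field_simps)
  moreover have "card A = card (A \<inter> Pow P) + card (A - Pow P)"
    using finite_AB by (metis card_Int_Diff)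
  moreover define a e where "a = real (card A) / 2 ^ l" and "e = real (card (A - Pow P)) / 2 ^ l"
  ultimately have "2 * a \<le> 1 + 2 * e" by (simp add: add_divide_distrib)
  moreover have "e \<le> a / 3 + 10 * d" unfolding a_def e_def
    by (rule extras_upper(1)[OF _ V]) (rule Q)
  moreover have "1 - d \<le> a" unfolding a_def by (rule extras_upper(2)[OF _ V]) (rule Q)
  ultimately show False using d_nonneg d_small by linarith
qed

text \<open>In units of \<open>2 ^ l\<close>, \<open>e\<close> and \<open>f\<close> count the members of \<open>A\<close> and \<open>B\<close> outside \<open>Pow P\<close> and \<open>Pow Q\<close>,
  while \<open>t\<close> and \<open>m\<close> count the members of \<open>Pow P\<close> and \<open>Pow Q\<close> that are absent.\<close>

lemma structure_of_partition:
  assumes P: "\<And>i. i \<in> P \<Longrightarrow> (1/3 - d) * card A \<le> card {x \<in> A. i \<in> x}"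
    and Q: "\<And>i. i \<in> Q \<Longrightarrow> (1/3 - d) * card B \<le> card {y \<in> B. i \<in> y}"
    and V: "P \<union> Q = V" "P \<inter> Q = {}" and cP: "card P = l"
  shows "card (A - Pow P) + card (Pow P - A) + card (B - Pow Q) + card (Pow Q - B)
    \<le> 20000 * d * 2 ^ l"
proof -
  interpret s: near_generating_pair V B A l d by (rule swap)
  have finPQ: "finite P" "finite Q" using finite_V V by auto
  have "card V = card P + card Q" unfolding V(1)[symmetric] using V finPQ by (intro card_Un_disjoint) auto
  hence cQ: "card Q = Suc l" using card_V cP by simp
  let ?A' = "A - Pow P" and ?B' = "B - Pow Q" and ?mB = "Pow Q - B"
  define N :: real where "N = 2 ^ l"
  have N: "0 < N" "2 ^ (2 * l) = N * N" by (simp_all add: N_def mult_2 power_add)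
  define a b where "a = real (card A) / N" and "b = real (card B) / N"
  define e f t m z where "e = real (card ?A') / N" and "f = real (card ?B') / N"
    and "t = real (card (Pow P - A)) / N" and "m = real (card ?mB) / N"
    and "z = real (card (disjoint_pairs ?A' ?B')) / (N * N)"
  have fin: "finite ?A'" "finite ?B'" "finite ?mB" using finite_AB finPQ by auto
  have V': "V \<subseteq> P \<union> Q" "V \<subseteq> Q \<union> P" using V by auto
  note ext = extras_upper[OF Q V'(1), folded N_def, folded a_def b_def e_def]
    s.extras_upper(1)[OF P V'(2), folded N_def, folded a_def b_def f_def]
  have a: "a = 1 - t + e"
  proof -
    have "card A = card (A \<inter> Pow P) + card ?A'" using finite_AB by (metis card_Int_Diff)
    moreover have "card (Pow P) = card (A \<inter> Pow P) + card (Pow P - A)"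
      using finPQ by (metis card_Int_Diff finite_Pow_iff Int_commute)
    ultimately have "real (card A) + real (card (Pow P - A)) = real (2 ^ l) + real (card ?A')"
      unfolding card_Pow[OF finPQ(1)] cP of_nat_add[symmetric] by simp
    hence "real (card A) = N - real (card (Pow P - A)) + real (card ?A')" by (simp add: N_def)
    thus ?thesis using N by (simp add: a_def t_def e_def field_simps)
  qed
  have b: "b = 2 - m + f"
  proof -
    have "card B = card (B \<inter> Pow Q) + card ?B'" using finite_AB by (metis card_Int_Diff)
    moreover have "card (Pow Q) = card (B \<inter> Pow Q) + card ?mB"
      using finPQ by (metis card_Int_Diff finite_Pow_iff Int_commute)
    ultimately have "real (card B) + real (card ?mB) = real (2 ^ Suc l) + real (card ?B')"
      unfolding card_Pow[OF finPQ(2)] cQ of_nat_add[symmetric] by simp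
    hence "real (card B) = 2 * N - real (card ?mB) + real (card ?B')" by (simp add: N_def)
    thus ?thesis using N by (simp add: b_def m_def f_def field_simps)
  qed
  \<comment> \<open>Inclusion-exclusion for intersecting pairs with an extra member on the left or
    on the right. Pairs with both are counted twice; their number is \<open>e * f - z\<close> in
    these units.\<close>
  have waste: "e * (1/3 - d) * b + f * (1/3 - d) * a - e * f + z \<le> a * b - 2 + d"
  proof -
    let ?X = "{(x, y) \<in> ?A' \<times> B. x \<inter> y \<noteq> {}}" and ?Y = "{(x, y) \<in> A \<times> ?B'. x \<inter> y \<noteq> {}}"
    let ?W = "{(x, y) \<in> A \<times> B. x \<inter> y \<noteq> {}}"
    have finW: "finite ?W" by (rule finite_subset[of _ "A \<times> B"]) (use finite_AB in auto)
    have sub: "?X \<subseteq> ?W" "?Y \<subseteq> ?W" by auto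
    have int: "?X \<inter> ?Y = {(x, y) \<in> ?A' \<times> ?B'. x \<inter> y \<noteq> {}}" by auto
    have "card (?X \<union> ?Y) \<le> card ?W" using sub by (intro card_mono[OF finW] Un_least)
    moreover have "card ?X + card ?Y = card (?X \<union> ?Y) + card {(x, y) \<in> ?A' \<times> ?B'. x \<inter> y \<noteq> {}}"
      unfolding int[symmetric]
      by (rule card_Un_Int[OF finite_subset[OF sub(1) finW] finite_subset[OF sub(2) finW]])
    moreover note card_disjoint_pairs_complement[OF fin(1,2)]
    ultimately have "card ?X + card ?Y + card (disjoint_pairs ?A' ?B') \<le> card ?W + card ?A' * card ?B'"
      by linarith
    hence "real (card ?X + card ?Y + card (disjoint_pairs ?A' ?B'))
        \<le> real (card ?W + card ?A' * card ?B')"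
      by (simp only: of_nat_le_iff)
    moreover have "card {(y, x) \<in> ?B' \<times> A. y \<inter> x \<noteq> {}} = card ?Y"
      unfolding card_pairs_swap[of A ?B' "\<lambda>x y. x \<inter> y \<noteq> {}"] by (simp only: Int_commute)
    ultimately have "card ?A' * ((1/3 - d) * card B) + card ?B' * ((1/3 - d) * card A)
        + card (disjoint_pairs ?A' ?B')
        \<le> real (card A) * real (card B) - (2 - d) * (N * N) + real (card ?A') * real (card ?B')"
      using extras_waste[OF Q V'(1)] s.extras_waste[OF P V'(2)] nondisjoint_upper N by simp
    hence "(card ?A' * ((1/3 - d) * card B) + card ?B' * ((1/3 - d) * card A)
        + card (disjoint_pairs ?A' ?B')) / (N * N)
        \<le> (real (card A) * real (card B) - (2 - d) * (N * N) + real (card ?A') * real (card ?B')) / (N * N)"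
      using N by (intro divide_right_mono) auto
    thus ?thesis using N
      by (simp add: a_def b_def e_def f_def z_def add_divide_distrib diff_divide_distrib algebra_simps)
  qed
  \<comment> \<open>For \<open>y \<in> Pow Q - B\<close>, every \<open>p \<union> y\<close> with \<open>p \<subseteq> P\<close> must be generated through an extra member of
    \<open>A\<close> with trace \<open>p\<close> on \<open>P\<close>, or through an extra member of \<open>B\<close>; the latter meets \<open>P\<close> and so is
    disjoint from at most half of \<open>Pow P\<close>.\<close>
  have miss: "m * (1 - e) \<le> f/2 + z + d"
  proof -
    let ?u = "\<lambda>(p, y). p \<union> y"
    let ?T = "?u ` (Pow P \<times> ?mB)"
    \<comment> \<open>Indexing by the missing trace on \<open>Q\<close>, and not by the member of
      \<open>B\<close> used, bounds this part by \<open>e * m\<close>, which then moves to the left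
      side as \<open>m * (1 - e)\<close>.\<close>
    let ?U1 = "(\<lambda>(x, y). (x \<inter> P) \<union> y) ` (?A' \<times> ?mB)"
    let ?R2 = "{(y, x) \<in> ?B' \<times> Pow P. x \<inter> y = {}}"
    let ?U2 = "(\<lambda>(y, x). x \<union> y) ` ?R2"
    let ?U3 = "?u ` disjoint_pairs ?A' ?B'"
    have "inj_on ?u (Pow P \<times> ?mB)"
    proof (rule inj_onI, clarify)
      fix p y p' y' assume *: "p \<subseteq> P" "p' \<subseteq> P" "y \<subseteq> Q" "y' \<subseteq> Q" "p \<union> y = p' \<union> y'"
      have "p = (p \<union> y) \<inter> P" "y = (p \<union> y) \<inter> Q" using * V by auto
      moreover have "p' = (p' \<union> y') \<inter> P" "y' = (p' \<union> y') \<inter> Q" using * V by auto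
      ultimately show "p = p' \<and> y = y'" using *(5) by metis
    qed
    hence cT: "card ?T = 2 ^ l * card ?mB"
      by (simp add: card_image card_cartesian_product card_Pow[OF finPQ(1)] cP)
    have finR2: "finite ?R2" by (rule finite_subset[of _ "?B' \<times> Pow P"]) (use fin finPQ in auto)
    have "card ?T \<le> card (Pow V - disjoint_unions A B) + card (?U1 \<union> (?U2 \<union> ?U3))"
    proof (rule card_le_missing_plus_cover[OF finite_V])
      show "?T \<subseteq> Pow V" using V by auto
      show "finite (?U1 \<union> (?U2 \<union> ?U3))"
        using fin finR2 by (auto intro!: finite_disjoint_pairs)
      fix x y assume *: "x \<in> A" "y \<in> B" "x \<inter> y = {}" "x \<union> y \<in> ?T"
      then obtain p q where pq: "p \<subseteq> P" "q \<subseteq> Q" "q \<notin> B" "x \<union> y = p \<union> q" by auto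
      show "x \<union> y \<in> ?U1 \<union> (?U2 \<union> ?U3)"
      proof (cases "y \<subseteq> Q")
        case True
        have xP: "x \<inter> P = p" 
        proof -
          have "(x \<union> y) \<inter> P = x \<inter> P" using True V by auto
          moreover have "(p \<union> q) \<inter> P = p" using pq V by auto
          ultimately show ?thesis using pq by simp
        qed
        have "x \<notin> Pow P"
        proof
          assume "x \<in> Pow P"
          hence "(x \<union> y) \<inter> Q = y" using True V by auto
          moreover have "(p \<union> q) \<inter> Q = q" using pq V by auto
          ultimately show False using pq * by metis
        qed
        hence "(x, q) \<in> ?A' \<times> ?mB" using pq * by auto
        hence "x \<union> y \<in> ?U1" by (rule rev_image_eqI) (simp add: xP pq)
        thus ?thesis ..
      next
        case False
        show ?thesis
        proof (cases "x \<subseteq> P")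
          case True
          hence "(y, x) \<in> ?R2" using * False by auto
          hence "x \<union> y \<in> ?U2" by (rule rev_image_eqI) simp
          thus ?thesis by blast
        next
          case F2: False
          hence "(x, y) \<in> disjoint_pairs ?A' ?B'" using * False by (auto simp: disjoint_pairs_def)
          hence "x \<union> y \<in> ?U3" by (rule rev_image_eqI) simp
          thus ?thesis by blast
        qed
      qed
    qed
    moreover have "card (?U1 \<union> (?U2 \<union> ?U3)) \<le> card ?U1 + (card ?U2 + card ?U3)"
      using card_Un_le[of ?U1 "?U2 \<union> ?U3"] card_Un_le[of ?U2 ?U3] by linarith
    moreover have "card ?U1 \<le> card ?A' * card ?mB"
      using card_image_le[of "?A' \<times> ?mB" "\<lambda>(x, y). (x \<inter> P) \<union> y"] fin by (simp add: card_cartesian_product)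
    moreover have "card ?U3 \<le> card (disjoint_pairs ?A' ?B')"
      using fin by (intro card_image_le finite_disjoint_pairs) auto
    moreover have "card ?U2 \<le> card ?R2" using finR2 by (intro card_image_le)
    ultimately have "2 ^ l * card ?mB \<le> card (Pow V - disjoint_unions A B)
        + (card ?A' * card ?mB + (card ?R2 + card (disjoint_pairs ?A' ?B')))"
      unfolding cT by linarith
    hence "real (2 ^ l * card ?mB) \<le> real (card (Pow V - disjoint_unions A B)
        + (card ?A' * card ?mB + (card ?R2 + card (disjoint_pairs ?A' ?B'))))"
      by (simp only: of_nat_le_iff)
    moreover have "card ?R2 \<le> real (card ?B') * (N / 2)"
    proof (rule card_pairs_upper)
      fix y assume "y \<in> ?B'"
      then obtain j where j: "j \<in> y" "j \<in> P" using B_sub V by auto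
      have "{x \<in> Pow P. x \<inter> y = {}} \<subseteq> Pow (P - {j})" using j by auto
      hence "card {x \<in> Pow P. x \<inter> y = {}} \<le> card (Pow (P - {j}))"
        using finPQ by (intro card_mono) auto
      also have "\<dots> = 2 ^ (l - 1)" using finPQ j cP by (simp add: card_Pow)
      finally have "real (card {x \<in> Pow P. x \<inter> y = {}}) \<le> real (2 ^ (l - 1))" by (simp only: of_nat_le_iff)
      moreover have "l \<noteq> 0" using cP j finPQ by (auto simp: card_gt_0_iff)
      hence "real (2 ^ (l - 1)) = N / 2" by (cases l) (auto simp: N_def)
      ultimately show "card {x \<in> Pow P. x \<inter> y = {}} \<le> N / 2" by (simp only:)
    qed (use fin finPQ in auto)
    ultimately have "N * card ?mB \<le> d * (N * N)
        + (real (card ?A') * card ?mB + (real (card ?B') * (N / 2) + card (disjoint_pairs ?A' ?B')))"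
      using missing N by (simp add: N_def)
    hence "N * card ?mB / (N * N) \<le> (d * (N * N)
        + (real (card ?A') * card ?mB + (real (card ?B') * (N / 2) + card (disjoint_pairs ?A' ?B')))) / (N * N)"
      using N by (intro divide_right_mono) auto
    thus ?thesis using N
      by (simp add: m_def e_def f_def z_def add_divide_distrib algebra_simps)
  qed
  have "e + t + f + m \<le> 20000 * d"
  proof (rule stability_inequalities[OF d_nonneg d_small refl])
    show "0 \<le> e" "0 \<le> f" "0 \<le> t" "0 \<le> m" "0 \<le> a" "0 \<le> b"
      using N by (simp_all add: e_def f_def t_def m_def a_def b_def)
  qed (use a b ext miss waste in auto)
  thus ?thesis using N by (simp add: e_def t_def f_def m_def N_def[symmetric] field_simps)
qed

text \<open>Both parts of the partition have at least \<open>l\<close> points and together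
  \<open>2 * l + 1\<close>, so one has exactly \<open>l\<close>; this one is \<open>S\<close>. The
  disjunction records which family lives mostly on it.\<close>

lemma complementary_structure:
  obtains S where "S \<subseteq> V" "card S = l"
    "card (A - Pow S) + card (Pow S - A) + card (B - Pow (V - S)) + card (Pow (V - S) - B)
       \<le> 20000 * d * 2 ^ l \<or>
     card (B - Pow S) + card (Pow S - B) + card (A - Pow (V - S)) + card (Pow (V - S) - A)
       \<le> 20000 * d * 2 ^ l"
proof -
  interpret s: near_generating_pair V B A l d by (rule swap)
  \<comment> \<open>Each coordinate goes to the side on which it is relatively more frequent.\<close>
  define P where "P = {i \<in> V. card {y \<in> B. i \<in> y} * card A \<le> card {x \<in> A. i \<in> x} * card B}"
  have P: "(1/3 - d) * card A \<le> card {x \<in> A. i \<in> x}" if "i \<in> P" for i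
    using that s.marginal_lower[of i] by (simp add: P_def)
  have Q: "(1/3 - d) * card B \<le> card {y \<in> B. i \<in> y}" if "i \<in> V - P" for i
    using that marginal_lower[of i] by (auto simp: P_def)
  have PV: "P \<subseteq> V" by (auto simp: P_def)
  have fin: "finite P" "finite (V - P)" using PV finite_V by (auto intro: finite_subset)
  have V: "P \<union> (V - P) = V" "(V - P) \<union> P = V" "V \<subseteq> P \<union> (V - P)" "V \<subseteq> (V - P) \<union> P"
    and VP: "V - (V - P) = P" using PV by auto
  have "l \<le> card P" by (rule card_part_lower[OF Q V(3) fin(1)])
  moreover have "l \<le> card (V - P)" by (rule s.card_part_lower[OF P V(4) fin(2)])
  moreover have "card (V - P) = 2 * l + 1 - card P" using card_V PV fin by (simp add: card_Diff_subset)
  ultimately consider "card P = l" | "card (V - P) = l" by linarith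
  thus ?thesis
  proof cases
    case 1
    show ?thesis
      by (rule that[OF PV 1]) (use structure_of_partition[OF P Q V(1) _ 1] in auto)
  next
    case 2
    show ?thesis
      by (rule that[OF _ 2]) (use s.structure_of_partition[OF Q P V(2) _ 2] VP in auto)
  qed
qed

end

section \<open>Stability of 2-generators\<close>

lemma k_union_2_cases:
  assumes "k_union G 2 X"
  obtains "X = {}" | "X \<in> G" | x y where "x \<in> G" "y \<in> G" "x \<inter> y = {}" "X = x \<union> y"
proof -
  from assms obtain C where C: "C \<subseteq> G" "finite C" "card C \<le> 2" "disjoint C" "\<Union>C = X"
    by (auto simp: k_union_def)
  from C(3) consider "card C = 0" | "card C = 1" | "card C = 2" by linarith
  thus thesis
  proof cases
    case 1
    thus thesis using C that(1) by simp
  next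
    case 2
    then obtain x where "C = {x}" by (rule card_1_singletonE)
    thus thesis using C that(2) by simp
  next
    case 3
    then obtain x y where xy: "C = {x, y}" "x \<noteq> y" by (auto simp: card_2_iff)
    hence "x \<inter> y = {}" using C(4) by (auto dest: disjointD)
    thus thesis using C xy that(3) by auto
  qed
qed

text \<open>A generated set is empty, a member of \<open>G\<close>, or the union of a disjoint pair.
  The first two kinds number at most \<open>1 + card G\<close>; a pair not split by \<open>A\<close>
  accounts for at most one set, and a split pair gives a disjoint union.\<close>

lemma missing_unions_bound:
  fixes \<delta> :: real
  assumes gen: "approx_generator n \<delta> 2 G" and A: "A \<subseteq> G"
  shows "card (Pow {1..n} - disjoint_unions A (G - A))
    \<le> \<delta> * 2 ^ n + (1 + card G + card {(x, y) \<in> G \<times> G. x \<inter> y = {} \<and> (x \<in> A \<longleftrightarrow> y \<in> A)})"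
proof -
  let ?M = "{(x, y) \<in> G \<times> G. x \<inter> y = {} \<and> (x \<in> A \<longleftrightarrow> y \<in> A)}"
  let ?N = "{X \<in> Pow {1..n}. \<not> k_union G 2 X}"
  let ?u = "\<lambda>(x, y). x \<union> y"
  have G: "G \<subseteq> Pow {1..n}" and N: "card ?N \<le> \<delta> * 2 ^ n"
    using gen by (auto simp: approx_generator_def)
  have finG: "finite G" using G by (rule finite_subset) simp
  have finM: "finite ?M" by (rule finite_subset[of _ "G \<times> G"]) (use finG in auto)
  have "Pow {1..n} - disjoint_unions A (G - A) \<subseteq> ?N \<union> (insert {} G \<union> ?u ` ?M)"
  proof (rule subsetI, rule ccontr)
    fix X assume X: "X \<in> Pow {1..n} - disjoint_unions A (G - A)" "X \<notin> ?N \<union> (insert {} G \<union> ?u ` ?M)"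
    hence "k_union G 2 X" by auto
    thus False
    proof (cases rule: k_union_2_cases)
      case (3 x y)
      have "(x, y) \<notin> ?M"
      proof
        assume "(x, y) \<in> ?M"
        hence "X \<in> ?u ` ?M" by (rule rev_image_eqI) (simp add: 3)
        thus False using X by simp
      qed
      hence "(x, y) \<in> disjoint_pairs A (G - A) \<or> (y, x) \<in> disjoint_pairs A (G - A)"
        using 3 by (auto simp: disjoint_pairs_def)
      hence "X \<in> disjoint_unions A (G - A)"
        unfolding disjoint_unions_def
        by (elim disjE; intro rev_image_eqI) (auto simp: 3)
      thus False using X by simp
    qed (use X in auto)
  qed
  hence "card (Pow {1..n} - disjoint_unions A (G - A)) \<le> card (?N \<union> (insert {} G \<union> ?u ` ?M))"
    using finG finM by (intro card_mono) auto
  also have "\<dots> \<le> card ?N + (card (insert {} G) + card (?u ` ?M))"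
    by (intro order_trans[OF card_Un_le] add_left_mono card_Un_le)
  also have "\<dots> \<le> card ?N + ((1 + card G) + card ?M)"
    using finG by (intro add_mono card_image_le[OF finM] order_refl) (simp add: card_insert_if)
  finally have "real (card (Pow {1..n} - disjoint_unions A (G - A))) \<le> real (card ?N + ((1 + card G) + card ?M))"
    by (simp only: of_nat_le_iff)
  thus ?thesis using N by simp
qed

lemma card_sym_diff_parts:
  assumes "finite A" "finite B" "finite C" "finite D"
  shows "card (sym_diff (A \<union> B) (C \<union> D)) \<le> card (A - C) + card (C - A) + card (B - D) + card (D - B)"
proof -
  have "sym_diff (A \<union> B) (C \<union> D) \<subseteq> (A - C) \<union> (C - A) \<union> (B - D) \<union> (D - B)" by auto
  hence "card (sym_diff (A \<union> B) (C \<union> D)) \<le> card ((A - C) \<union> (C - A) \<union> (B - D) \<union> (D - B))"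
    using assms by (intro card_mono) auto
  also have "\<dots> \<le> card (A - C) + card (C - A) + card (B - D) + card (D - B)"
    by (intro order_trans[OF card_Un_le] add_right_mono order_refl)
  finally show ?thesis .
qed

theorem theorem3:
  fixes eps' :: real
  assumes "eps' > 0"
  shows "\<exists>\<delta>::real. \<delta> > 0 \<and> (\<exists>n0::nat. \<forall>l::nat. \<forall>G::nat set set.
           2 * l + 1 \<ge> n0 \<longrightarrow>
           approx_generator (2 * l + 1) \<delta> 2 G \<longrightarrow>
           card G \<le> 3 * 2 ^ l \<longrightarrow>
           (\<exists>S. S \<subseteq> {1..2 * l + 1} \<and> card S = l \<and>
              real (card (sym_diff G (Pow S \<union> Pow ({1..2 * l + 1} - S))))
                \<le> eps' * 2 ^ l))"
proof -
  \<comment> \<open>The first bound is required by \<open>near_generating_pair\<close>, the second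
    turns its conclusion \<open>20000 * d\<close> into \<open>eps'\<close>.\<close>
  define d where "d = min (1/100000) (eps' / 20000)"
  have d: "0 < d" "d \<le> 1/100000" "20000 * d \<le> eps'" using assms by (auto simp: d_def)
  have "0 < d / 4" using d by simp
  from nearly_bipartite[OF this, where 'a = nat] obtain l0 where
    "\<forall>l\<ge>l0. \<forall>G :: nat set set. \<forall>V. finite V \<longrightarrow> card V = 2 * l + 1 \<longrightarrow> G \<subseteq> Pow V
      \<longrightarrow> card G \<le> 3 * 2 ^ l
      \<longrightarrow> (\<exists>A\<subseteq>G. card {(x, y) \<in> G \<times> G. x \<inter> y = {} \<and> (x \<in> A \<longleftrightarrow> y \<in> A)} \<le> d / 4 * 2 ^ (2 * l))"
    by (rule exE)
  note l0 = this[rule_format]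
  obtain l1 where l1: "8 / d < 2 ^ l1" using real_arch_pow[of 2] by auto
  have "\<exists>S. S \<subseteq> {1..2 * l + 1} \<and> card S = l \<and>
      real (card (sym_diff G (Pow S \<union> Pow ({1..2 * l + 1} - S)))) \<le> eps' * 2 ^ l"
    if l: "2 * l + 1 \<ge> 2 * max l0 l1 + 1" and gen: "approx_generator (2 * l + 1) (d / 8) 2 G"
      and card_G: "card G \<le> 3 * 2 ^ l" for l and G :: "nat set set"
  proof -
    define V where "V = {1..2 * l + 1}"
    have V: "finite V" "card V = 2 * l + 1" by (simp_all add: V_def)
    have G: "G \<subseteq> Pow V" using gen by (simp add: approx_generator_def V_def)
    have finG: "finite G" using G by (rule finite_subset) (simp add: V)
    obtain A where A: "A \<subseteq> G"
      "card {(x, y) \<in> G \<times> G. x \<inter> y = {} \<and> (x \<in> A \<longleftrightarrow> y \<in> A)} \<le> d / 4 * 2 ^ (2 * l)"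
      using l0[OF _ V G card_G] l by auto
    define B where "B = G - A"
    have AB: "G = A \<union> B" "A \<inter> B = {}" using A by (auto simp: B_def)
    have fin: "finite A" "finite B" using finG AB by auto
    have "card A + card B = card G" using AB fin by (simp add: card_Un_disjoint)
    hence card_AB: "card A + card B \<le> 3 * 2 ^ l" using card_G by simp
    \<comment> \<open>Budget in units of \<open>2 ^ (2 * l)\<close>: \<open>d / 4\<close> for
      ungenerated sets (since \<open>2 ^ n\<close> is two units), \<open>d / 4\<close> for
      monochromatic pairs, and \<open>d / 2\<close> for \<open>1 + card G\<close>, by the choice of
      \<open>l1\<close>.\<close>
    have "card (Pow V - disjoint_unions A B) \<le> d * 2 ^ (2 * l)"
    proof -
      have "8 / d < 2 ^ l" by (rule less_le_trans[OF l1]) (use l in \<open>simp add: power_increasing\<close>)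
      hence "8 \<le> d * 2 ^ l" using d by (simp add: field_simps)
      hence "8 * 2 ^ l \<le> d * 2 ^ l * 2 ^ l" by (intro mult_right_mono) auto
      hence big: "4 * 2 ^ l \<le> d / 2 * 2 ^ (2 * l)" by (simp add: mult_2 power_add)
      have "real (card G) \<le> real (3 * 2 ^ l)" using card_G by (simp only: of_nat_le_iff)
      hence "real (card G) \<le> 3 * 2 ^ l" by simp
      moreover have "(1::real) \<le> 2 ^ l" by simp
      ultimately have "1 + real (card G) \<le> 4 * 2 ^ l" by linarith
      moreover have "d / 8 * 2 ^ (2 * l + 1) = d / 4 * 2 ^ (2 * l)" by simp
      ultimately show ?thesis
        using missing_unions_bound[OF gen A(1), folded V_def B_def] A(2) big by simp
    qed
    then interpret near_generating_pair V A B l d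
      using V G AB card_AB d by unfold_locales auto
    obtain S where S: "S \<subseteq> V" "card S = l" and or:
      "card (A - Pow S) + card (Pow S - A) + card (B - Pow (V - S)) + card (Pow (V - S) - B)
         \<le> 20000 * d * 2 ^ l \<or>
       card (B - Pow S) + card (Pow S - B) + card (A - Pow (V - S)) + card (Pow (V - S) - A)
         \<le> 20000 * d * 2 ^ l" by (rule complementary_structure)
    have finS: "finite (Pow S)" "finite (Pow (V - S))" using S(1) V(1) by (auto intro: finite_subset)
    have "real (card (sym_diff G (Pow S \<union> Pow (V - S)))) \<le> 20000 * d * 2 ^ l"
      using or
    proof
      assume "card (A - Pow S) + card (Pow S - A) + card (B - Pow (V - S)) + card (Pow (V - S) - B)
         \<le> 20000 * d * 2 ^ l"
      thus ?thesis using card_sym_diff_parts[OF fin finS] unfolding AB(1)[symmetric] by linarith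
    next
      assume "card (B - Pow S) + card (Pow S - B) + card (A - Pow (V - S)) + card (Pow (V - S) - A)
         \<le> 20000 * d * 2 ^ l"
      thus ?thesis using card_sym_diff_parts[OF fin(2,1) finS]
        unfolding AB(1)[symmetric] Un_commute[of B A] by linarith
    qed
    also have "\<dots> \<le> eps' * 2 ^ l" using d by (intro mult_right_mono) auto
    finally show ?thesis using S unfolding V_def by blast
  qed
  thus ?thesis using d(1)
    by (intro exI[of _ "d / 8"] conjI exI[of _ "2 * max l0 l1 + 1"] allI impI) auto
qed

end
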